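(* Let $\theta\in(0,1]$ and let $(p_i)_{i\ge1}$ be a probability distribution on the positive integers of the form $p_i=i^{-1/\theta}\,l(i,\theta)$, where $x\mapsto l(x,\theta)$ is a slowly varying function as $x\to\infty$. Let $A$ be a function on $[0,1]$ satisfying the conditions stated in the context. Then the estimator $$\widehat\theta=\widehat\theta_n=\int_0^1 \log^+ R_{[nt]}\,dA(t)$$ is strongly consistent: $\widehat\theta_n\to\theta$ almost surely as $n\to\infty$.
   Context: Model: words are drawn one by one, independently, from a countably infinite dictionary $\{1,2,\dots\}$, the $i$-th word being drawn with probability $p_i>0$, $\sum_i p_i=1$. For $j\ge1$, $R_j$ denotes the number of distinct words among the first $j$ draws; $R_0=0$. $[x]$ is the integer part of $x$, and $\log^+x=\max(\log x,0)$ (with $\log^+0=0$). The weight function $A:[0,1]\to\mathbb R$ is the sum of a step function and a piecewise continuously differentiable function on $[0,1]$, and satisfies $\int_0^1\log t\,dA(t)=1$ and $A(0)=A(0+)=A(1)=0$; integrals $\int\cdot\,dA$ are Lebesgue–Stieltjes integrals. *)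

theory Defs
  imports "HOL-Probability.Probability"
begin

definition logp :: "real \<Rightarrow> real" where
  "logp x = (if x \<le> 0 then 0 else max (ln x) 0)"

definition slowly_varying :: "(real \<Rightarrow> real) \<Rightarrow> bool" where
  "slowly_varying L \<longleftrightarrow>
     (\<exists>a. (\<forall>x\<ge>a. L x > 0) \<and> set_borel_measurable borel {a..} L) \<and>
     (\<forall>c>0. ((\<lambda>x. L (c * x) / L x) \<longlongrightarrow> 1) at_top)"

definition step_fun_01 :: "(real \<Rightarrow> real) \<Rightarrow> bool" where
  "step_fun_01 S \<longleftrightarrow>
     (\<exists>P. finite P \<and> P \<subseteq> {0..1} \<and> 0 \<in> P \<and> 1 \<in> P \<and>
        (\<forall>x y. 0 \<le> x \<and> x \<le> y \<and> y \<le> 1 \<and> {x..y} \<inter> P = {} \<longrightarrow> S x = S y))"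

definition piecewise_C1_01 :: "(real \<Rightarrow> real) \<Rightarrow> bool" where
  "piecewise_C1_01 C \<longleftrightarrow> continuous_on {0..1} C \<and>
     (\<exists>P. finite P \<and> P \<subseteq> {0..1} \<and> 0 \<in> P \<and> 1 \<in> P \<and>
        (\<forall>a\<in>P. \<forall>b\<in>P. a < b \<and> {a<..<b} \<inter> P = {} \<longrightarrow>
           (\<exists>g g'. continuous_on {a..b} g' \<and>
              (\<forall>x\<in>{a..b}. (g has_real_derivative g' x) (at x within {a..b})) \<and>
              (\<forall>x\<in>{a<..<b}. C x = g x))))"

text \<open>Mass of the Lebesgue--Stieltjes measure dA on [0,1] at the point t:
  A(t+) - A(t-), with A(1+) := A(1) and A(0-) := A(0).\<close>
definition jump :: "(real \<Rightarrow> real) \<Rightarrow> real \<Rightarrow> real" where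
  "jump A t = (if t = 1 then A 1 else Lim (at_right t) A)
              - (if t = 0 then A 0 else Lim (at_left t) A)"

text \<open>Lebesgue--Stieltjes integral over [0,1] with respect to a function A that is the sum
  of a step function and a piecewise C^1 function: atomic part (finitely many jumps) plus
  absolutely continuous part with density A'.\<close>
definition LS_integral :: "(real \<Rightarrow> real) \<Rightarrow> (real \<Rightarrow> real) \<Rightarrow> real" where
  "LS_integral f A =
     (\<Sum>t\<in>{t\<in>{0..1}. jump A t \<noteq> 0}. f t * jump A t)
     + integral {0..1} (\<lambda>t. f t * deriv A t)"

definition R :: "nat \<Rightarrow> nat stream \<Rightarrow> nat" where
  "R j \<omega> = card (set (stake j \<omega>))"

definition theta_hat :: "(real \<Rightarrow> real) \<Rightarrow> nat \<Rightarrow> nat stream \<Rightarrow> real" where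
  "theta_hat A n \<omega> = LS_integral (\<lambda>t. logp (real (R (nat \<lfloor>real n * t\<rfloor>) \<omega>))) A"

end

theory Submission
  imports Defs "HOL-Real_Asymp.Real_Asymp"
begin

text \<open>
  With \<open>q i = - ln (1 - p i)\<close>, the expected number of distinct words among \<open>n\<close> draws is \<open>\<Phi> n\<close>, where
  \<open>\<Phi> x = (\<Sum>i. 1 - exp (- (x * q i)))\<close>. Since \<open>q (k * i + r) / q i\<close> tends to \<open>k powr (- 1 / \<theta>)\<close> for
  every residue \<open>r < k\<close>, splitting the sum into residue classes modulo \<open>k\<close> gives
  \<open>\<Phi> (k powr (1 / \<theta>) * x) \<sim> k * \<Phi> x\<close>; passing to quotients and using monotonicity, \<open>\<Phi>\<close> is regularly
  varying with index \<open>\<theta>\<close>. This treats \<open>\<theta> < 1\<close> and \<open>\<theta> = 1\<close> alike and needs no monotonicity of \<open>p\<close>.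
  Occurrences of distinct words are negatively correlated, so the variance of \<open>R n\<close> is at most \<open>\<Phi> n\<close>,
  and Chebyshev's inequality with Borel--Cantelli yields \<open>R n \<sim> \<Phi> n\<close> almost surely.
  As \<open>dA\<close> has total mass \<open>A 1 - A 0 = 0\<close>, the estimator is the integral of
  \<open>log R [n t] - log R n\<close>, which converges to \<open>\<theta> * log t\<close>. Concavity of \<open>\<Phi>\<close> bounds the integrand by
  \<open>K - log t\<close>, and dominated convergence finishes the proof.
\<close>

section \<open>Slowly varying functions along arithmetic progressions\<close>

text \<open>Averaging over an intermediate point reduces moving steps to fixed ones, for which
  dominated convergence applies. This is a weak additive form of the uniform convergence theorem for
  slowly varying functions.\<close>

lemma tendsto_diff_of_slow_increments:
  fixes h :: "real \<Rightarrow> real" and x y :: "nat \<Rightarrow> real"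
  assumes [measurable]: "h \<in> borel_measurable borel"
    and slow: "\<And>u. ((\<lambda>z. h (z + u) - h z) \<longlongrightarrow> 0) at_top"
    and x: "filterlim x at_top sequentially"
    and xy: "\<And>n. x n \<le> y n" "\<And>n. y n \<le> x n + 1"
  shows "(\<lambda>n. h (y n) - h (x n)) \<longlonglongrightarrow> 0"
proof -
  have y: "filterlim y at_top sequentially"
    by (rule filterlim_at_top_mono[OF x]) (use xy in auto)
  \<comment> \<open>Truncation at 1 keeps the triangle inequality and supplies a dominating
    function, although \<open>h\<close> may be unbounded on bounded sets.\<close>
  define f where "f z u = min 1 \<bar>h (z + u) - h z\<bar>" for z u
  have [measurable]: "f z \<in> borel_measurable borel" for z
    unfolding f_def by measurable
  have f01: "0 \<le> f z u" "f z u \<le> 1" for z u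
    by (auto simp: f_def)
  have int: "integrable lborel (\<lambda>u. indicator {a..b} (u + e) * f z (u + d))" for a b z d e
  proof (rule Bochner_Integration.integrable_bound)
    have "integrable lborel (indicator {a - e..b - e} :: real \<Rightarrow> real)"
      by (rule integrable_real_indicator) (auto simp: emeasure_lborel_Icc_eq)
    then show "integrable lborel (\<lambda>u. indicator {a..b} (u + e) :: real)"
      by (rule Bochner_Integration.integrable_cong[THEN iffD1, rotated 2])
         (auto simp: indicator_def)
  qed (use f01 in \<open>auto simp: indicator_def\<close>)
  \<comment> \<open>For \<open>u\<close> in [1,2] the offset \<open>u + (x n - y n)\<close> stays in
    [0,2], so this window serves both base points.\<close>
  define I where "I z = (LINT u|lborel. indicator {0..2} u * f z u)" for z
  have lim: "(\<lambda>n. I (z n)) \<longlonglongrightarrow> 0" if z: "filterlim z at_top sequentially" for z :: "nat \<Rightarrow> real"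
  proof -
    have "(\<lambda>n. LINT u|lborel. indicator {0..2} u * f (z n) u) \<longlonglongrightarrow> (LINT (u::real)|lborel. (0::real))"
    proof (rule integral_dominated_convergence(1)[where w = "indicator {0..2::real}"])
      show "AE u in lborel. (\<lambda>n. indicator {0..2} u * f (z n) u) \<longlonglongrightarrow> 0"
      proof (rule AE_I2)
        fix u :: real
        have "(\<lambda>n. f (z n) u) \<longlonglongrightarrow> min 1 \<bar>0\<bar>"
          unfolding f_def
          by (intro tendsto_intros filterlim_compose[OF slow] z)
        then show "(\<lambda>n. indicator {0..2} u * f (z n) u) \<longlonglongrightarrow> 0"
          by (intro tendsto_mult_right_zero) simp
      qed
    qed (use f01 in \<open>auto simp: indicator_def\<close>)
    then show ?thesis by (simp add: I_def)
  qed
  \<comment> \<open>For every \<open>u\<close> in \<open>[1,2]\<close>, the triangle inequality through the point \<open>x n + u\<close>, averaged over \<open>u\<close>.\<close>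
  have le: "min 1 \<bar>h (y n) - h (x n)\<bar> \<le> I (x n) + I (y n)" for n
  proof -
    let ?d = "x n - y n" and ?c = "min 1 \<bar>h (y n) - h (x n)\<bar>"
    have "?c = (LINT (u::real)|lborel. indicator {1..2} u * ?c)"
      by simp
    also have "\<dots> \<le> (LINT u|lborel. indicator {0..2} u * f (x n) u
                        + indicator {0..2} (u + ?d) * f (y n) (u + ?d))"
    proof (rule integral_mono)
      show "integrable lborel (\<lambda>u. indicator {0..2} u * f (x n) u
                        + indicator {0..2} (u + ?d) * f (y n) (u + ?d))"
        using int[of 0 2 0 "x n" 0] int[of 0 2 ?d "y n" ?d] by simp
      fix u :: real
      have "min 1 \<bar>h (y n) - h (x n)\<bar> \<le> f (x n) u + f (y n) (u + ?d)"
        by (auto simp: f_def algebra_simps min_def)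
      then show "indicator {1..2} u * ?c \<le> indicator {0..2} u * f (x n) u
                        + indicator {0..2} (u + ?d) * f (y n) (u + ?d)"
        using xy[of n] f01 by (auto simp: indicator_def)
    qed simp
    also have "\<dots> = I (x n) + (LINT u|lborel. indicator {0..2} (u + ?d) * f (y n) (u + ?d))"
      using int[of 0 2 0 "x n" 0] int[of 0 2 ?d "y n" ?d] by (simp add: I_def)
    also have "(LINT u|lborel. indicator {0..2} (u + ?d) * f (y n) (u + ?d)) = I (y n)"
      unfolding I_def
      using lborel_integral_real_affine[of 1 "\<lambda>u. indicator {0..2} u * f (y n) u" ?d]
      by (simp add: add.commute)
    finally show ?thesis .
  qed
  have "(\<lambda>n. min 1 \<bar>h (y n) - h (x n)\<bar>) \<longlonglongrightarrow> 0"
  proof (rule tendsto_sandwich[OF _ _ tendsto_const])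
    show "(\<lambda>n. I (x n) + I (y n)) \<longlonglongrightarrow> 0"
      using tendsto_add[OF lim[OF x] lim[OF y]] by simp
  qed (use le in auto)
  then have "(\<lambda>n. \<bar>h (y n) - h (x n)\<bar>) \<longlonglongrightarrow> 0"
    by (rule Lim_transform_eventually)
       (use order_tendstoD(2)[OF \<open>(\<lambda>n. min 1 _) \<longlonglongrightarrow> 0\<close>, of 1] in \<open>auto elim!: eventually_mono\<close>)
  then show ?thesis
    by (rule tendsto_rabs_zero_cancel)
qed

text \<open>On the logarithmic scale \<open>k * i + r\<close> and \<open>k * i\<close> differ by at
  most \<open>ln 2\<close> for positive \<open>i\<close>, so the lemma on slow increments compares
  them; slow variation with factor \<open>k\<close> then compares \<open>k * i\<close> with
  \<open>i\<close>.\<close>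

lemma slowly_varying_ratio_affine:
  fixes k r :: nat
  assumes "slowly_varying L" "r < k"
  shows "(\<lambda>i. L (real (k * i + r)) / L (real i)) \<longlonglongrightarrow> 1"
proof -
  from assms(1) obtain a where pos: "\<And>x. a \<le> x \<Longrightarrow> L x > 0"
    and meas: "set_borel_measurable borel {a..} L"
    and lim: "\<And>c. c > 0 \<Longrightarrow> ((\<lambda>x. L (c * x) / L x) \<longlongrightarrow> 1) at_top"
    unfolding slowly_varying_def by blast
  \<comment> \<open>Measurability of \<open>L\<close> is available only on \<open>{a..}\<close>;
    cutting \<open>L\<close> off below \<open>a\<close> gives a function measurable
    everywhere.\<close>
  define g where "g x = indicator {a..} x *\<^sub>R L x" for x
  have [measurable]: "g \<in> borel_measurable borel"
    using meas unfolding g_def set_borel_measurable_def by simp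
  define h where "h x = ln (g (exp x))" for x
  have h: "h x = ln (L (exp x))" if "exp x \<ge> a" for x
    using that by (simp add: h_def g_def)
  have slow: "((\<lambda>z. h (z + u) - h z) \<longlongrightarrow> 0) at_top" for u
  proof -
    have 1: "((\<lambda>z. ln (L (exp u * exp z) / L (exp z))) \<longlongrightarrow> ln 1) at_top"
      by (rule tendsto_ln[OF filterlim_compose[OF lim exp_at_top]]) auto
    have "\<forall>\<^sub>F z in at_top. exp z \<ge> a"
      using exp_at_top by (simp add: filterlim_at_top)
    moreover have "\<forall>\<^sub>F z in at_top. exp (z + u) \<ge> a"
    proof -
      have "filterlim (\<lambda>z. exp (z + u)) at_top at_top" by real_asymp
      then show ?thesis by (simp add: filterlim_at_top)
    qed
    ultimately have "\<forall>\<^sub>F z in at_top. ln (L (exp u * exp z) / L (exp z)) = h (z + u) - h z"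
      by eventually_elim
        (simp add: h ln_div pos less_imp_neq[OF pos, symmetric] exp_add mult.commute)
    with 1 show ?thesis
      by (simp add: filterlim_cong)
  qed
  have k: "k \<ge> 1" using assms(2) by simp
  \<comment> \<open>The shift to \<open>Suc i\<close> keeps the arguments of \<open>ln\<close>
    positive; it is undone at the end.\<close>
  define x where "x i = ln (real k * real (Suc i))" for i
  define y where "y i = ln (real (k * Suc i + r))" for i
  have "(\<lambda>i. h (y i) - h (x i)) \<longlonglongrightarrow> 0"
  proof (rule tendsto_diff_of_slow_increments[OF _ slow])
    show "h \<in> borel_measurable borel" unfolding h_def by measurable
    show "filterlim x at_top sequentially" unfolding x_def using k by real_asymp
    fix i
    show "x i \<le> y i" unfolding x_def y_def using k
      by (subst ln_le_cancel_iff) (auto simp: algebra_simps intro!: add_pos_nonneg)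
    have "real (k * Suc i + r) \<le> 2 * (real k * real (Suc i))"
      using assms(2) by (simp add: algebra_simps add_increasing2)
    then have "y i \<le> ln (2 * (real k * real (Suc i)))"
      unfolding y_def using k by (subst ln_le_cancel_iff) (auto intro!: add_pos_nonneg)
    also have "\<dots> = ln 2 + x i"
      unfolding x_def using k by (subst ln_mult) auto
    also have "ln 2 \<le> (1::real)"
      using ln_le_minus_one[of 2] by simp
    finally show "y i \<le> x i + 1" by simp
  qed
  then have "(\<lambda>i. exp (h (y i) - h (x i))) \<longlonglongrightarrow> exp 0"
    by (intro tendsto_intros)
  moreover have large: "\<forall>\<^sub>F i in sequentially. real i \<ge> a"
    using filterlim_real_sequentially by (simp add: filterlim_at_top)
  then have "\<forall>\<^sub>F i in sequentially. exp (h (y i) - h (x i))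
      = L (real (k * Suc i + r)) / L (real k * real (Suc i))"
  proof eventually_elim
    case (elim i)
    have "real (Suc i) \<le> real k * real (Suc i)" using k by simp
    then have 1: "a \<le> real k * real (Suc i)" "a \<le> real (k * Suc i + r)"
      using elim unfolding of_nat_add of_nat_mult[of k] by linarith+
    have 2: "exp (x i) = real k * real (Suc i)" "exp (y i) = real (k * Suc i + r)"
      unfolding x_def y_def using k by (intro exp_ln; simp add: add_pos_nonneg)+
    show ?case
      using 1 unfolding exp_diff by (simp add: h 2 pos)
  qed
  ultimately have "(\<lambda>i. L (real (k * Suc i + r)) / L (real k * real (Suc i))) \<longlonglongrightarrow> 1"
    by (simp add: filterlim_cong)
  moreover have "(\<lambda>i. L (real k * real (Suc i)) / L (real (Suc i))) \<longlonglongrightarrow> 1"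
    using k by (intro filterlim_compose[OF lim]) (auto, real_asymp)
  ultimately have "(\<lambda>i. (L (real (k * Suc i + r)) / L (real k * real (Suc i)))
      * (L (real k * real (Suc i)) / L (real (Suc i)))) \<longlonglongrightarrow> 1 * 1"
    by (rule tendsto_mult)
  then have "(\<lambda>i. L (real (k * Suc i + r)) / L (real (Suc i))) \<longlonglongrightarrow> 1"
    unfolding mult_1
  proof (rule Lim_transform_eventually)
    show "\<forall>\<^sub>F i in sequentially. L (real (k * Suc i + r)) / L (real k * real (Suc i))
      * (L (real k * real (Suc i)) / L (real (Suc i))) = L (real (k * Suc i + r)) / L (real (Suc i))"
      using large
    proof (eventually_elim)
      case (elim i)
      have "real (Suc i) \<le> real k * real (Suc i)" using k by simp
      then have "a \<le> real k * real (Suc i)" using elim by linarith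
      from pos[OF this] show ?case by simp
    qed
  qed
  then show ?thesis
    by (subst filterlim_sequentially_Suc[symmetric])
qed

section \<open>Regular variation of the mean number of distinct words\<close>

text \<open>For nonnegative summable \<open>q\<close> this is the Bernstein function (Laplace
  exponent) of the measure with unit mass at each \<open>q i\<close>, hence monotone, concave and
  subadditive.\<close>

definition occ_mean :: "(nat \<Rightarrow> real) \<Rightarrow> real \<Rightarrow> real" where
  "occ_mean q x = (\<Sum>i. 1 - exp (- (x * q i)))"

text \<open>The function \<open>1 - exp (- y)\<close> is concave and vanishes at 0. The proof rests
  on \<open>y * exp (- y) \<le> 1 - exp (- y)\<close>, which is \<open>1 + y \<le> exp y\<close>
  rescaled.\<close>

lemma one_minus_exp_scale:
  fixes y c :: real
  assumes "y \<ge> 0" "c \<ge> 1"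
  shows "1 - exp (- (c * y)) \<le> c * (1 - exp (- y))"
proof -
  have "1 + y \<le> exp y" by (rule exp_ge_add_one_self)
  then have "(1 + y) * exp (- y) \<le> exp y * exp (- y)"
    by (rule mult_right_mono) simp
  then have 1: "y * exp (- y) \<le> 1 - exp (- y)"
    by (simp add: algebra_simps flip: exp_add)
  have "exp (- y) - exp (- (c * y)) = exp (- y) * (1 - exp (- ((c - 1) * y)))"
    by (simp add: algebra_simps flip: exp_add)
  also have "\<dots> \<le> exp (- y) * ((c - 1) * y)"
    using exp_ge_add_one_self[of "- ((c - 1) * y)"] by (intro mult_left_mono) auto
  also have "\<dots> = (c - 1) * (y * exp (- y))" by simp
  also have "\<dots> \<le> (c - 1) * (1 - exp (- y))"
    using 1 assms by (intro mult_left_mono) auto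
  finally show ?thesis by (simp add: algebra_simps)
qed

text \<open>A relative error in the exponent costs no more than the same relative error in the term,
  so perturbing the rates produces an error proportional to the mean itself.\<close>

lemma one_minus_exp_diff_le:
  fixes a b e :: real
  assumes "0 \<le> b" "0 < e" "e < 1" "(1 - e) * b \<le> a" "a \<le> (1 + e) * b"
  shows "\<bar>(1 - exp (- a)) - (1 - exp (- b))\<bar> \<le> e * (1 - exp (- b))"
proof -
  have "1 - exp (- a) \<le> 1 - exp (- ((1 + e) * b))"
    using assms by simp
  also have "\<dots> \<le> (1 + e) * (1 - exp (- b))"
    using assms by (intro one_minus_exp_scale) auto
  finally have up: "1 - exp (- a) \<le> (1 + e) * (1 - exp (- b))" .
  \<comment> \<open>The lower estimate is the scaling bound with factor \<open>1 / (1 - e)\<close>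
    at the point \<open>(1 - e) * b\<close>.\<close>
  have "1 - exp (- b) = 1 - exp (- (1 / (1 - e) * ((1 - e) * b)))"
    using assms by simp
  also have "\<dots> \<le> 1 / (1 - e) * (1 - exp (- ((1 - e) * b)))"
    using assms by (intro one_minus_exp_scale) auto
  finally have "(1 - e) * (1 - exp (- b)) \<le> 1 - exp (- ((1 - e) * b))"
    using assms by (simp add: field_simps)
  also have "\<dots> \<le> 1 - exp (- a)"
    using assms by simp
  finally show ?thesis
    using up by (simp add: abs_le_iff algebra_simps)
qed

locale summable_rates =
  fixes q :: "nat \<Rightarrow> real"
  assumes q_nonneg: "\<And>i. 0 \<le> q i" and q_summable: "summable q"
begin

lemma occ_term_bounds:
  assumes "0 \<le> x"
  shows "0 \<le> 1 - exp (- (x * q i))" "1 - exp (- (x * q i)) \<le> 1"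
    "1 - exp (- (x * q i)) \<le> x * q i"
  using mult_nonneg_nonneg[OF assms q_nonneg[of i]] exp_ge_add_one_self[of "- (x * q i)"] by auto

lemma summable_occ_term:
  assumes "0 \<le> x"
  shows "summable (\<lambda>i. 1 - exp (- (x * q i)))"
proof (rule summable_comparison_test[OF _ summable_mult[OF q_summable, of x]])
  have "norm (1 - exp (- (x * q i))) \<le> x * q i" for i
    using occ_term_bounds[OF assms, of i] by (simp only: real_norm_def abs_of_nonneg)
  then show "\<exists>N. \<forall>n\<ge>N. norm (1 - exp (- (x * q n))) \<le> x * q n" by blast
qed

lemma occ_mean_nonneg: "0 \<le> x \<Longrightarrow> 0 \<le> occ_mean q x"
  unfolding occ_mean_def by (intro suminf_nonneg summable_occ_term occ_term_bounds(1))

lemma occ_mean_mono: "0 \<le> x \<Longrightarrow> x \<le> y \<Longrightarrow> occ_mean q x \<le> occ_mean q y"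
  unfolding occ_mean_def
  by (intro suminf_le summable_occ_term) (auto intro: mult_right_mono q_nonneg)

text \<open>Concavity term by term. It serves twice later: to show that the integer part in
  \<open>[n t]\<close> is harmless, and to bound logarithmic increments.\<close>

lemma occ_mean_scale_le:
  assumes "0 \<le> x" "1 \<le> c"
  shows "occ_mean q (c * x) \<le> c * occ_mean q x"
proof -
  have "occ_mean q (c * x) \<le> (\<Sum>i. c * (1 - exp (- (x * q i))))"
    unfolding occ_mean_def
    using one_minus_exp_scale[OF mult_nonneg_nonneg[OF assms(1) q_nonneg] assms(2)] assms
    by (intro suminf_le summable_occ_term summable_mult) (auto simp: mult.assoc)
  also have "\<dots> = c * occ_mean q x"
    unfolding occ_mean_def by (intro suminf_mult summable_occ_term assms)
  finally show ?thesis .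
qed

text \<open>Subadditivity, from expanding a product of two nonnegative terms. It keeps the steps of
  the mean bounded, so that the mean cannot jump far over a prescribed level.\<close>

lemma occ_mean_Suc_le: "0 \<le> x \<Longrightarrow> occ_mean q (x + 1) \<le> occ_mean q x + occ_mean q 1"
proof -
  assume x: "0 \<le> x"
  have le: "1 - exp (- ((x + 1) * q i)) \<le> (1 - exp (- (x * q i))) + (1 - exp (- (1 * q i)))" for i
  proof -
    have "0 \<le> (1 - exp (- (x * q i))) * (1 - exp (- (1 * q i)))"
      using x q_nonneg[of i] by (intro mult_nonneg_nonneg) auto
    then show ?thesis by (simp add: algebra_simps flip: exp_add)
  qed
  have "occ_mean q (x + 1) \<le> (\<Sum>i. (1 - exp (- (x * q i))) + (1 - exp (- (1 * q i))))"
    unfolding occ_mean_def using x by (intro suminf_le summable_add summable_occ_term le) auto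
  also have "\<dots> = occ_mean q x + occ_mean q 1"
    unfolding occ_mean_def using x by (intro suminf_add[symmetric] summable_occ_term) auto
  finally show ?thesis .
qed

end

text \<open>Words are numbered from 1 while sequences start at 0; hence positivity is asked only
  from index 1 on.\<close>

locale positive_rates = summable_rates +
  assumes q_pos: "\<And>i. 1 \<le> i \<Longrightarrow> 0 < q i"
begin

lemma occ_mean_pos:
  assumes "0 < x"
  shows "0 < occ_mean q x"
  unfolding occ_mean_def
  using assms occ_term_bounds[of x] q_pos[of 1]
  by (intro suminf_pos2[where i = 1] summable_occ_term) auto

lemma occ_mean_at_top: "filterlim (occ_mean q) at_top at_top"
  unfolding filterlim_at_top
proof
  fix Z :: real
  obtain n :: nat where n: "Z < real n" using reals_Archimedean2 by blast
  have "((\<lambda>x. \<Sum>i\<in>{1..n}. 1 - exp (- (x * q i))) \<longlongrightarrow> (\<Sum>i\<in>{1..n}. 1 - 0)) at_top"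
  proof (intro tendsto_sum tendsto_diff tendsto_const)
    fix i assume "i \<in> {1..n}"
    then have "q i > 0" using q_pos by simp
    then show "((\<lambda>x. exp (- (x * q i))) \<longlongrightarrow> 0) at_top" by real_asymp
  qed
  then have "\<forall>\<^sub>F x in at_top. Z < (\<Sum>i\<in>{1..n}. 1 - exp (- (x * q i)))"
    using n by (intro order_tendstoD(1)) auto
  with eventually_ge_at_top[of 0] show "\<forall>\<^sub>F x in at_top. Z \<le> occ_mean q x"
  proof eventually_elim
    case (elim x)
    have "(\<Sum>i\<in>{1..n}. 1 - exp (- (x * q i))) \<le> occ_mean q x"
      unfolding occ_mean_def
      using elim by (intro sum_le_suminf summable_occ_term occ_term_bounds) auto
    then show ?case using elim by simp
  qed
qed

text \<open>Cut the series at \<open>c * x\<close> into residue classes modulo \<open>k\<close>. In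
  each class the rates times \<open>c\<close> approach \<open>q i\<close>, so every class
  contributes asymptotically one copy of \<open>occ_mean q x\<close>.\<close>

lemma occ_mean_ratio_nat:
  fixes k :: nat
  assumes k: "1 \<le> k" and c: "0 < c"
    and lim: "\<And>r. r < k \<Longrightarrow> (\<lambda>i. q (k * i + r) / q i) \<longlonglongrightarrow> 1 / c"
  shows "((\<lambda>x. occ_mean q (c * x) / occ_mean q x) \<longlongrightarrow> real k) at_top"
proof -
  let ?f = "\<lambda>x i. 1 - exp (- (x * q i))"
  have split: "occ_mean q (c * x) = (\<Sum>r<k. \<Sum>i. ?f (c * x) (k * i + r))"
    and summ: "r < k \<Longrightarrow> summable (\<lambda>i. ?f (c * x) (k * i + r))" if "x > 0" for x r
  proof -
    have s: "summable (?f (c * x))"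
      using that c by (intro summable_occ_term) auto
    have sub: "summable (\<lambda>i. ?f (c * x) (k * i + r))" for r
      using summable_reindex[OF s, of "\<lambda>i. k * i + r"] occ_term_bounds(1)[of "c * x"] that c k
      by (auto simp: inj_def o_def)
    show "r < k \<Longrightarrow> summable (\<lambda>i. ?f (c * x) (k * i + r))" using sub .
    have "(\<lambda>n. sum (?f (c * x)) {n * k..<n * k + k}) sums occ_mean q (c * x)"
      unfolding occ_mean_def using s k by (intro sums_group summable_sums) auto
    moreover have "sum (?f (c * x)) {n * k..<n * k + k} = (\<Sum>r<k. ?f (c * x) (k * n + r))" for n
      by (rule sum.reindex_bij_witness[of _ "\<lambda>r. k * n + r" "\<lambda>j. j - n * k"])
         (auto simp: algebra_simps)
    ultimately have "occ_mean q (c * x) = (\<Sum>n. \<Sum>r<k. ?f (c * x) (k * n + r))"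
      by (simp add: sums_iff)
    also have "\<dots> = (\<Sum>r<k. \<Sum>i. ?f (c * x) (k * i + r))"
      by (rule suminf_sum) (rule sub)
    finally show "occ_mean q (c * x) = (\<Sum>r<k. \<Sum>i. ?f (c * x) (k * i + r))" .
  qed
  \<comment> \<open>The point is that \<open>N\<close> is independent of \<open>x\<close>: finitely
    many uncontrolled terms cost a constant, the others a small multiple of the mean.\<close>
  have bound: "\<exists>N::nat. \<forall>x>0. \<bar>occ_mean q (c * x) - k * occ_mean q x\<bar> \<le> k * (N + e * occ_mean q x)"
    if e: "0 < e" "e < 1" for e
  proof -
    have "\<forall>\<^sub>F i in sequentially. \<forall>r\<in>{..<k}. dist (c * (q (k * i + r) / q i)) 1 < e"
    proof (rule eventually_ball_finite, simp, rule ballI, rule tendstoD)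
      fix r assume "r \<in> {..<k}"
      then have "(\<lambda>i. c * (q (k * i + r) / q i)) \<longlonglongrightarrow> c * (1 / c)"
        by (intro tendsto_mult tendsto_const lim) simp
      then show "(\<lambda>i. c * (q (k * i + r) / q i)) \<longlonglongrightarrow> 1" using c by simp
    qed (rule e)
    then obtain N0 where N0: "\<And>i r. i \<ge> N0 \<Longrightarrow> r < k \<Longrightarrow> dist (c * (q (k * i + r) / q i)) 1 < e"
      unfolding eventually_sequentially by auto
    \<comment> \<open>The maximum with 1 excludes index 0, where \<open>q\<close> might
      vanish.\<close>
    define N where "N = max 1 N0"
    have "\<bar>occ_mean q (c * x) - k * occ_mean q x\<bar> \<le> k * (N + e * occ_mean q x)" if x: "x > 0" for x
    proof -
      have sx: "summable (?f x)"
        using x by (intro summable_occ_term) auto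
      have part: "\<bar>(\<Sum>i. ?f (c * x) (k * i + r)) - occ_mean q x\<bar> \<le> N + e * occ_mean q x" if r: "r < k" for r
      proof -
        \<comment> \<open>Dominating series: the trivial bound 1 for the first \<open>N\<close>
          terms, the relative error throughout.\<close>
        let ?g = "\<lambda>i. of_bool (i < N) + e * ?f x i"
        have le: "norm (?f (c * x) (k * i + r) - ?f x i) \<le> ?g i" for i
        proof (cases "i < N")
          case True
          have "\<bar>?f (c * x) (k * i + r) - ?f x i\<bar> \<le> 1"
          proof -
            have *: "\<bar>a - b\<bar> \<le> 1" if "0 \<le> a" "a \<le> 1" "0 \<le> b" "b \<le> 1" for a b :: real
              using that by linarith
            show ?thesis
              using x c by (intro * occ_term_bounds) auto
          qed
          moreover have "0 \<le> e * ?f x i"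
            using occ_term_bounds(1)[of x i] x e by (intro mult_nonneg_nonneg) auto
          ultimately show ?thesis using True by simp
        next
          case False
          then have i: "i \<ge> N0" "q i > 0" by (auto simp: N_def q_pos)
          have "\<bar>c * (q (k * i + r) / q i) - 1\<bar> \<le> e"
            using N0[OF i(1) r] by (simp add: dist_real_def)
          then have "(1 - e) * q i \<le> c * q (k * i + r)" "c * q (k * i + r) \<le> (1 + e) * q i"
            using i(2) by (auto simp: abs_le_iff field_simps)
          then have "x * ((1 - e) * q i) \<le> x * (c * q (k * i + r))"
              "x * (c * q (k * i + r)) \<le> x * ((1 + e) * q i)"
            using x by (auto intro!: mult_left_mono)
          then have "\<bar>?f (c * x) (k * i + r) - ?f x i\<bar> \<le> e * ?f x i"
            using x e q_nonneg[of i]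
            by (intro one_minus_exp_diff_le) (auto simp: algebra_simps)
          then show ?thesis using False by simp
        qed
        have g1: "(\<lambda>i. of_bool (i < N)) sums (\<Sum>i<N. 1::real)"
          using sums_If_finite_set[of "{..<N}" "\<lambda>_. 1::real"] by (simp add: of_bool_def)
        have g: "?g sums (N + e * occ_mean q x)"
          using sums_add[OF g1 sums_mult[OF summable_sums[OF sx], of e]]
          by (simp add: occ_mean_def)
        have "norm (\<Sum>i. ?f (c * x) (k * i + r) - ?f x i) \<le> suminf ?g"
          by (rule norm_suminf_le[OF le]) (use g in \<open>simp add: sums_iff\<close>)
        also have "suminf ?g = N + e * occ_mean q x"
          using g by (simp add: sums_iff)
        finally show ?thesis
          by (simp only: suminf_diff[OF summ[OF x r] sx, symmetric] occ_mean_def real_norm_def)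
      qed
      have "occ_mean q (c * x) - k * occ_mean q x
          = (\<Sum>r<k. (\<Sum>i. ?f (c * x) (k * i + r)) - occ_mean q x)"
        using split[OF x] by (simp add: sum_subtractf)
      also have "\<bar>\<dots>\<bar> \<le> (\<Sum>r<k. N + e * occ_mean q x)"
        by (rule order_trans[OF sum_abs sum_mono]) (use part in auto)
      finally show ?thesis by simp
    qed
    then show ?thesis by blast
  qed
  show ?thesis
  proof (rule tendstoI)
    fix d :: real assume d: "d > 0"
    \<comment> \<open>Half of \<open>d\<close> is reserved for \<open>k * e\<close>, half for
      \<open>k * N / occ_mean q x\<close>; the bound 1/2 keeps \<open>e\<close> below 1.\<close>
    define e where "e = min (1/2) (d / (2 * real k))"
    have e: "0 < e" "e < 1" using d k by (auto simp: e_def)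
    obtain N :: nat where N: "\<And>x. x > 0 \<Longrightarrow> \<bar>occ_mean q (c * x) - k * occ_mean q x\<bar> \<le> k * (N + e * occ_mean q x)"
      using bound[OF e] by blast
    have "\<forall>\<^sub>F x in at_top. occ_mean q x > 2 * real k * N / d"
      using occ_mean_at_top by (simp add: filterlim_at_top_dense)
    with eventually_gt_at_top[of 0]
    show "\<forall>\<^sub>F x in at_top. dist (occ_mean q (c * x) / occ_mean q x) (real k) < d"
    proof eventually_elim
      case (elim x)
      have pos: "occ_mean q x > 0" using elim by (intro occ_mean_pos)
      have "occ_mean q (c * x) / occ_mean q x - k = (occ_mean q (c * x) - k * occ_mean q x) / occ_mean q x"
        using pos by (simp add: field_simps)
      then have "dist (occ_mean q (c * x) / occ_mean q x) (real k)
          = \<bar>occ_mean q (c * x) - k * occ_mean q x\<bar> / occ_mean q x"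
        using pos by (simp add: dist_real_def abs_divide)
      also have "\<dots> \<le> k * (N + e * occ_mean q x) / occ_mean q x"
        using N[OF elim(1)] pos by (intro divide_right_mono) auto
      also have "\<dots> = k * N / occ_mean q x + k * e"
        using pos by (simp add: field_simps)
      also have "k * e \<le> d / 2"
        using k by (simp add: e_def min_def field_simps)
      also have "k * N / occ_mean q x < d / 2"
        using elim(2) pos d by (simp add: field_simps)
      finally show ?case by simp
    qed
  qed
qed

text \<open>Scaling by \<open>k powr (1 / \<theta>)\<close> multiplies the mean by \<open>k\<close>
  asymptotically; quotients give all positive rational factors, and monotonicity squeezes an
  arbitrary \<open>c\<close> between them, so no Tauberian theorem enters.\<close>

lemma occ_mean_regularly_varying:
  assumes theta: "0 < \<theta>"
    and lim: "\<And>k r. r < k \<Longrightarrow> (\<lambda>i. q (k * i + r) / q i) \<longlonglongrightarrow> real k powr (- 1 / \<theta>)"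
    and c: "0 < c"
  shows "((\<lambda>x. occ_mean q (c * x) / occ_mean q x) \<longlongrightarrow> c powr \<theta>) at_top"
proof -
  have nat: "((\<lambda>x. occ_mean q (real k powr (1 / \<theta>) * x) / occ_mean q x) \<longlongrightarrow> real k) at_top"
    if "k \<ge> 1" for k
    using that lim[of _ k] by (intro occ_mean_ratio_nat) (auto simp: powr_minus_divide)
  have rat: "((\<lambda>x. occ_mean q (r powr (1 / \<theta>) * x) / occ_mean q x) \<longlongrightarrow> r) at_top"
    if r: "r \<in> \<rat>" "r > 0" for r
  proof -
    obtain m k :: nat where "m \<noteq> 0" "\<bar>r\<bar> = real k / real m"
      by (rule Rats_abs_nat_div_natE[OF r(1)])
    then have km: "m \<noteq> 0" "r = real k / real m"
      using r(2) by auto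
    then have k: "k \<ge> 1" using r(2) by (cases k) auto
    define M where "M = real m powr (1 / \<theta>)"
    have M: "M > 0" using km(1) by (simp add: M_def)
    \<comment> \<open>With \<open>x = M * w\<close>, the factor \<open>r = k / m\<close> becomes the
      quotient of the limits for \<open>k\<close> and for \<open>m\<close> at the same point
      \<open>w\<close>.\<close>
    let ?w = "\<lambda>x. x / M"
    have w: "filterlim ?w at_top at_top"
      using M by real_asymp
    have "((\<lambda>x. (occ_mean q (real k powr (1 / \<theta>) * ?w x) / occ_mean q (?w x)) /
        (occ_mean q (M * ?w x) / occ_mean q (?w x))) \<longlongrightarrow> real k / real m) at_top"
      using km k unfolding M_def by (intro tendsto_divide filterlim_compose[OF nat w[unfolded M_def]]) auto
    moreover have "\<forall>\<^sub>F x in at_top. (occ_mean q (real k powr (1 / \<theta>) * ?w x) / occ_mean q (?w x)) /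
        (occ_mean q (M * ?w x) / occ_mean q (?w x))
        = occ_mean q (r powr (1 / \<theta>) * x) / occ_mean q x"
      using eventually_gt_at_top[of 0]
    proof eventually_elim
      case (elim x)
      have "occ_mean q (?w x) > 0" using elim M by (intro occ_mean_pos) simp
      moreover have "real k powr (1 / \<theta>) * ?w x = r powr (1 / \<theta>) * x"
        using km by (simp add: powr_divide M_def)
      moreover have "M * ?w x = x" using M by simp
      ultimately show ?case by simp
    qed
    ultimately show ?thesis
      unfolding km(2) by (rule Lim_transform_eventually)
  qed
  have inv: "(s powr (1 / \<theta>)) powr \<theta> = s" if "s > 0" for s :: real
    using theta that by (simp add: powr_powr)
  have mono: "occ_mean q (a * x) / occ_mean q x \<le> occ_mean q (b * x) / occ_mean q x"
    if "0 < a" "a \<le> b" "0 < x" for a b x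
    using that by (intro divide_right_mono occ_mean_mono occ_mean_nonneg) (auto intro: mult_right_mono)
  show ?thesis
  proof (rule order_tendstoI)
    fix a assume "a < c powr \<theta>"
    \<comment> \<open>The maximum with 0 makes the rational \<open>s\<close> positive even when
      \<open>a\<close> is negative.\<close>
    then have "max a 0 < c powr \<theta>" using c by simp
    then obtain s where s: "s \<in> \<rat>" "max a 0 < s" "s < c powr \<theta>"
      using Rats_dense_in_real by blast
    have "s powr (1 / \<theta>) \<le> (c powr \<theta>) powr (1 / \<theta>)"
      using s theta by (intro powr_mono2) auto
    then have le: "s powr (1 / \<theta>) \<le> c"
      using c theta by (simp add: powr_powr)
    have "\<forall>\<^sub>F x in at_top. a < occ_mean q (s powr (1 / \<theta>) * x) / occ_mean q x"
      using order_tendstoD(1)[OF rat[OF s(1)]] s by simp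
    with eventually_gt_at_top[of 0]
    show "\<forall>\<^sub>F x in at_top. a < occ_mean q (c * x) / occ_mean q x"
    proof eventually_elim
      case (elim x)
      then show ?case using mono[OF _ le elim(1)] s by simp
    qed
  next
    fix a assume "c powr \<theta> < a"
    then obtain s where s: "s \<in> \<rat>" "c powr \<theta> < s" "s < a"
      using Rats_dense_in_real by blast
    have s0: "0 < s" using s(2) powr_ge_zero[of c \<theta>] by linarith
    have "(c powr \<theta>) powr (1 / \<theta>) \<le> s powr (1 / \<theta>)"
      using s theta by (intro powr_mono2) auto
    then have le: "c \<le> s powr (1 / \<theta>)"
      using c theta by (simp add: powr_powr)
    have "\<forall>\<^sub>F x in at_top. occ_mean q (s powr (1 / \<theta>) * x) / occ_mean q x < a"
      using order_tendstoD(2)[OF rat[OF s(1)]] s s0 by simp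
    with eventually_gt_at_top[of 0]
    show "\<forall>\<^sub>F x in at_top. occ_mean q (c * x) / occ_mean q x < a"
    proof eventually_elim
      case (elim x)
      then show ?case using mono[OF c le elim(1)] by simp
    qed
  qed
qed

end

section \<open>Almost sure asymptotics of the number of distinct words\<close>

lemma measurable_stake_pmf [measurable]:
  fixes D :: "nat pmf"
  shows "stake n \<in> stream_space (measure_pmf D) \<rightarrow>\<^sub>M count_space UNIV"
proof -
  have "sets (stream_space (measure_pmf D)) = sets (stream_space (count_space UNIV))"
    by (rule sets_stream_space_cong) simp
  from measurable_cong_sets[OF this refl] show ?thesis
    using measurable_stake by blast
qed

lemma sets_stake_event:
  fixes D :: "nat pmf"
  shows "{\<omega>. P (stake n \<omega>)} \<in> sets (stream_space (measure_pmf D))"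
  using measurable_sets[OF measurable_stake_pmf, of "{xs. P xs}" n D]
  by (simp add: vimage_def space_stream_space)

lemma measurable_R [measurable]:
  fixes D :: "nat pmf"
  shows "R n \<in> stream_space (measure_pmf D) \<rightarrow>\<^sub>M count_space UNIV"
  unfolding R_def by measurable

lemma space_stream_space_pmf [simp]: "space (stream_space (measure_pmf D)) = UNIV"
  by (simp add: space_stream_space)

text \<open>Independence, by splitting off the first draw. Absence of one word or of two words is
  the case of \<open>C\<close> being \<open>- {i}\<close> or \<open>- {i, j}\<close>.\<close>

lemma emeasure_stake_subset:
  fixes D :: "nat pmf"
  shows "emeasure (stream_space (measure_pmf D)) {\<omega>. set (stake n \<omega>) \<subseteq> C} = emeasure D C ^ n"
proof -
  let ?M = "stream_space (measure_pmf D)"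
  interpret M: prob_space ?M
    by (intro prob_space.prob_space_stream_space prob_space_measure_pmf)
  show ?thesis
  proof (induction n)
    case 0
    then show ?case using M.emeasure_space_1 by simp
  next
    case (Suc n)
    have "emeasure ?M {\<omega>. set (stake (Suc n) \<omega>) \<subseteq> C}
        = (\<integral>\<^sup>+t. emeasure ?M {\<omega> \<in> space ?M. t ## \<omega> \<in> {\<omega>. set (stake (Suc n) \<omega>) \<subseteq> C}} \<partial>D)"
      by (rule prob_space.emeasure_stream_space[OF prob_space_measure_pmf sets_stake_event])
    also have "\<dots> = (\<integral>\<^sup>+t. indicator C t * emeasure ?M {\<omega>. set (stake n \<omega>) \<subseteq> C} \<partial>D)"
      by (intro nn_integral_cong) (auto simp: indicator_def)
    also have "\<dots> = emeasure D C * emeasure D C ^ n"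
      by (simp add: nn_integral_multc Suc.IH)
    finally show ?case by simp
  qed
qed

lemma measure_stake_subset:
  fixes D :: "nat pmf"
  shows "measure (stream_space (measure_pmf D)) {\<omega>. set (stake n \<omega>) \<subseteq> C} = measure D C ^ n"
proof -
  interpret M: prob_space "stream_space (measure_pmf D)"
    by (intro prob_space.prob_space_stream_space prob_space_measure_pmf)
  show ?thesis
    using emeasure_stake_subset[of D n C]
    unfolding M.emeasure_eq_measure measure_pmf.emeasure_eq_measure ennreal_power[OF measure_nonneg]
    by simp
qed

lemma measure_in_stake:
  fixes D :: "nat pmf"
  shows "measure (stream_space (measure_pmf D)) {\<omega>. i \<in> set (stake n \<omega>)} = 1 - (1 - pmf D i) ^ n"
proof -
  let ?M = "stream_space (measure_pmf D)"
  interpret M: prob_space ?M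
    by (intro prob_space.prob_space_stream_space prob_space_measure_pmf)
  from M.prob_compl[OF sets_stake_event[of "\<lambda>xs. i \<in> set xs" n]]
  have "measure ?M {\<omega>. set (stake n \<omega>) \<subseteq> - {i}} = 1 - measure ?M {\<omega>. i \<in> set (stake n \<omega>)}"
    by (simp add: set_diff_eq Collect_neg_eq[symmetric] subset_Compl_singleton)
  moreover have "measure D (- {i}) = 1 - pmf D i"
    unfolding Compl_eq_Diff_UNIV
    using measure_pmf.prob_compl[of "{i}" D] by (simp add: measure_pmf_single)
  ultimately show ?thesis
    using measure_stake_subset[of D n "- {i}"] by simp
qed

text \<open>By inclusion-exclusion, negative correlation reduces to comparing the bases
  \<open>1 - pmf D i - pmf D j\<close> and \<open>(1 - pmf D i) * (1 - pmf D j)\<close>, which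
  differ by \<open>pmf D i * pmf D j\<close>.\<close>

lemma measure_both_in_stake_le:
  fixes D :: "nat pmf"
  assumes "i \<noteq> j"
  shows "measure (stream_space (measure_pmf D)) {\<omega>. i \<in> set (stake n \<omega>) \<and> j \<in> set (stake n \<omega>)}
    \<le> measure (stream_space (measure_pmf D)) {\<omega>. i \<in> set (stake n \<omega>)}
      * measure (stream_space (measure_pmf D)) {\<omega>. j \<in> set (stake n \<omega>)}"
proof -
  let ?M = "stream_space (measure_pmf D)"
  interpret M: prob_space ?M
    by (intro prob_space.prob_space_stream_space prob_space_measure_pmf)
  let ?A = "\<lambda>i. {\<omega>. i \<in> set (stake n \<omega>)}"
  have [measurable]: "?A i \<in> sets ?M" for i
    by (rule sets_stake_event)
  have "measure ?M (?A i \<union> ?A j) = measure ?M (?A i) + measure ?M (?A j) - measure ?M (?A i \<inter> ?A j)"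
    using measure_Un3[of "?A i" ?M "?A j"] by (simp add: M.fmeasurable_eq_sets)
  moreover have "measure ?M (?A i \<union> ?A j) = 1 - (1 - pmf D i - pmf D j) ^ n"
  proof -
    have "measure ?M (space ?M - (?A i \<union> ?A j)) = 1 - measure ?M (?A i \<union> ?A j)"
      by (rule M.prob_compl) measurable
    moreover have "space ?M - (?A i \<union> ?A j) = {\<omega>. set (stake n \<omega>) \<subseteq> - {i, j}}"
      by auto
    moreover have "measure D (- {i, j}) = 1 - pmf D i - pmf D j"
      unfolding Compl_eq_Diff_UNIV
      using measure_pmf.prob_compl[of "{i, j}" D] assms
      by (simp add: measure_measure_pmf_finite)
    ultimately show ?thesis by (simp add: measure_stake_subset)
  qed
  moreover have "(1 - pmf D i - pmf D j) ^ n \<le> (1 - pmf D i) ^ n * (1 - pmf D j) ^ n"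
    unfolding power_mult_distrib[symmetric]
  \<comment> \<open>The smaller base must be nonnegative, which holds because two different words
    have total mass at most 1.\<close>
  proof (rule power_mono)
    have "measure D {i, j} \<le> 1" by simp
    then show "0 \<le> 1 - pmf D i - pmf D j"
      using assms by (simp add: measure_measure_pmf_finite)
  qed (simp add: algebra_simps)
  moreover have "?A i \<inter> ?A j = {\<omega>. i \<in> set (stake n \<omega>) \<and> j \<in> set (stake n \<omega>)}"
    by auto
  ultimately show ?thesis
    by (simp add: measure_in_stake algebra_simps)
qed

section \<open>Moments and tail bound for the number of distinct words\<close>

lemma suminf_of_bool_eq_card:
  assumes "finite S"
  shows "(\<Sum>i. of_bool (i \<in> S) :: ennreal) = of_nat (card S)"
proof -
  have "(\<Sum>i. of_bool (i \<in> S) :: ennreal) = (\<Sum>i\<in>S. of_bool (i \<in> S))"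
    by (rule suminf_finite) (use assms in auto)
  then show ?thesis by simp
qed

text \<open>\<open>R n\<close> is a series of indicators, handled in \<open>ennreal\<close>, where
  sums and integrals interchange freely. In the square, negative correlation bounds off-diagonal
  pairs by products and the diagonal adds \<open>\<mu>\<close>, so the variance is at most
  \<open>\<mu>\<close>.\<close>

lemma R_moments:
  fixes D :: "nat pmf"
  assumes "(\<lambda>i. 1 - (1 - pmf D i) ^ n) sums \<mu>"
  shows "(\<integral>\<omega>. R n \<omega> \<partial>stream_space (measure_pmf D)) = \<mu>"
    and "(\<integral>\<omega>. (R n \<omega>)\<^sup>2 \<partial>stream_space (measure_pmf D)) \<le> \<mu>\<^sup>2 + \<mu>"
proof -
  let ?M = "stream_space (measure_pmf D)"
  let ?A = "\<lambda>i. {\<omega>. i \<in> set (stake n \<omega>)}"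
  interpret M: prob_space ?M
    by (intro prob_space.prob_space_stream_space prob_space_measure_pmf)
  have A [measurable]: "?A i \<in> sets ?M" for i
    by (rule sets_stake_event)
  have \<mu>: "(\<lambda>i. measure ?M (?A i)) sums \<mu>"
    using assms by (simp add: measure_in_stake)
  then have \<mu>0: "0 \<le> \<mu>"
    by (auto simp: sums_iff intro!: suminf_nonneg)
  have e\<mu>: "(\<Sum>i. emeasure ?M (?A i)) = ennreal \<mu>"
    unfolding M.emeasure_eq_measure by (rule suminf_ennreal_eq[OF measure_nonneg \<mu>])
  have R: "ennreal (R n \<omega>) = (\<Sum>i. indicator (?A i) \<omega>)" for \<omega>
    using suminf_of_bool_eq_card[OF finite_set, of "stake n \<omega>"]
    by (simp only: R_def indicator_def mem_Collect_eq ennreal_of_nat_eq_real_of_nat)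
  have "(\<integral>\<^sup>+\<omega>. ennreal (R n \<omega>) \<partial>?M) = ennreal \<mu>"
    unfolding R by (subst nn_integral_suminf) (simp_all only: nn_integral_indicator A e\<mu> borel_measurable_indicator)
  then show "(\<integral>\<omega>. R n \<omega> \<partial>?M) = \<mu>"
    using \<mu>0 by (subst integral_eq_nn_integral) auto
  have R2: "ennreal ((R n \<omega>)\<^sup>2) = (\<Sum>i. \<Sum>j. indicator (?A i \<inter> ?A j) \<omega>)" for \<omega>
  proof -
    have "ennreal ((R n \<omega>)\<^sup>2) = ennreal (R n \<omega>) * ennreal (R n \<omega>)"
      by (simp add: power2_eq_square ennreal_mult)
    also have "\<dots> = (\<Sum>i. \<Sum>j. indicator (?A i) \<omega> * indicator (?A j) \<omega>)"
      unfolding R by (simp only: ennreal_suminf_cmult ennreal_suminf_multc)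
    finally show ?thesis by (simp add: indicator_inter_arith)
  qed
  have "(\<integral>\<^sup>+\<omega>. ennreal ((R n \<omega>)\<^sup>2) \<partial>?M) = (\<Sum>i. \<Sum>j. emeasure ?M (?A i \<inter> ?A j))"
    unfolding R2
    by (simp only: nn_integral_suminf nn_integral_indicator A sets.Int borel_measurable_indicator
        borel_measurable_suminf_order)
  \<comment> \<open>On the diagonal the product is kept as a harmless nonnegative summand, which
    lets the double sum factor. Writing the diagonal as \<open>j \<in> {i}\<close> matches
    \<open>suminf_of_bool_eq_card\<close>.\<close>
  also have "\<dots> \<le> (\<Sum>i. \<Sum>j. emeasure ?M (?A i) * emeasure ?M (?A j)
                                 + emeasure ?M (?A i) * of_bool (j \<in> {i}))"
  proof (intro suminf_le summableI)
    fix i j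
    have neq: "emeasure ?M (?A i \<inter> ?A j) \<le> emeasure ?M (?A i) * emeasure ?M (?A j)" if "i \<noteq> j"
    proof -
      have "measure ?M (?A i \<inter> ?A j) \<le> measure ?M (?A i) * measure ?M (?A j)"
        using measure_both_in_stake_le[OF that, of D n] by (simp only: Collect_conj_eq)
      then show ?thesis
        by (simp only: M.emeasure_eq_measure ennreal_mult[symmetric] measure_nonneg ennreal_leI)
    qed
    show "emeasure ?M (?A i \<inter> ?A j) \<le> emeasure ?M (?A i) * emeasure ?M (?A j)
        + emeasure ?M (?A i) * of_bool (j \<in> {i})"
    proof (cases "i = j")
      case True
      show ?thesis
        by (simp only: True Int_absorb singletonI of_bool_eq mult_1_right)
           (rule add_increasing[OF zero_le order_refl])
    next
      case False
      then have "(j \<in> {i}) = False" by auto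
      then show ?thesis
        by (simp only: of_bool_eq mult_zero_right add_0_right neq[OF False])
    qed
  qed
  also have "\<dots> = (\<Sum>i. emeasure ?M (?A i) * ennreal \<mu> + emeasure ?M (?A i) * 1)"
    by (simp only: suminf_add[symmetric] summableI ennreal_suminf_cmult e\<mu>
        suminf_of_bool_eq_card finite.intros card.insert card.empty) simp
  also have "\<dots> = ennreal \<mu> * ennreal \<mu> + ennreal \<mu>"
    by (simp only: suminf_add[symmetric] summableI ennreal_suminf_multc e\<mu> mult_1_right)
  also have "\<dots> = ennreal (\<mu>\<^sup>2 + \<mu>)"
    using \<mu>0 by (simp add: power2_eq_square ennreal_mult ennreal_plus)
  finally have le: "(\<integral>\<^sup>+\<omega>. ennreal ((R n \<omega>)\<^sup>2) \<partial>?M) \<le> ennreal (\<mu>\<^sup>2 + \<mu>)" .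
  show "(\<integral>\<omega>. (R n \<omega>)\<^sup>2 \<partial>?M) \<le> \<mu>\<^sup>2 + \<mu>"
    using le \<mu>0 by (subst integral_eq_nn_integral) (auto intro!: enn2real_leI simp del: ennreal_plus)
qed

lemma R_le: "R n \<omega> \<le> n"
  unfolding R_def using card_length[of "stake n \<omega>"] by simp

lemma R_mono: "m \<le> n \<Longrightarrow> R m \<omega> \<le> R n \<omega>"
proof -
  assume "m \<le> n"
  then obtain k where "n = m + k" using le_Suc_ex by blast
  then have "stake n \<omega> = stake m \<omega> @ stake k (sdrop m \<omega>)"
    by (simp only: stake_add)
  then have "set (stake m \<omega>) \<subseteq> set (stake n \<omega>)"
    by (simp only: set_append Un_upper1)
  then show ?thesis
    unfolding R_def by (intro card_mono) auto
qed

lemma R_pos: "1 \<le> n \<Longrightarrow> 1 \<le> R n \<omega>"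
  by (cases n) (simp_all add: R_def Suc_le_eq card_gt_0_iff)

text \<open>Chebyshev with variance at most \<open>\<mu>\<close>; the trivial bound
  \<open>R n \<omega> \<le> n\<close> supplies integrability.\<close>

lemma R_tail_bound:
  fixes D :: "nat pmf"
  assumes \<mu>: "(\<lambda>i. 1 - (1 - pmf D i) ^ n) sums \<mu>" and a: "0 < a"
  shows "measure (stream_space (measure_pmf D)) {\<omega>. a \<le> \<bar>real (R n \<omega>) - \<mu>\<bar>} \<le> \<mu> / a\<^sup>2"
proof -
  let ?M = "stream_space (measure_pmf D)"
  interpret M: prob_space ?M
    by (intro prob_space.prob_space_stream_space prob_space_measure_pmf)
  have int: "integrable ?M (\<lambda>\<omega>. real (R n \<omega>))" "integrable ?M (\<lambda>\<omega>. (real (R n \<omega>))\<^sup>2)"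
    by (rule M.integrable_const_bound[where B = "real n"], simp add: R_le, measurable)
       (rule M.integrable_const_bound[where B = "(real n)\<^sup>2"], simp add: R_le, measurable)
  have "measure ?M {\<omega> \<in> space ?M. a \<le> \<bar>real (R n \<omega>) - M.expectation (\<lambda>\<omega>. real (R n \<omega>))\<bar>}
      \<le> M.variance (\<lambda>\<omega>. real (R n \<omega>)) / a\<^sup>2"
    by (rule M.Chebyshev_inequality) (use int a in auto)
  also have "M.variance (\<lambda>\<omega>. real (R n \<omega>)) \<le> \<mu>"
    using R_moments[OF \<mu>] by (subst M.variance_eq[OF int]) simp
  finally show ?thesis
    using R_moments(1)[OF \<mu>] a by (simp add: divide_right_mono)
qed

text \<open>Here \<open>\<kappa> n\<close> indexes a block containing \<open>n\<close>. On a block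
  both sequences lie between their endpoint values, and the values of \<open>\<mu>\<close> at the
  endpoints are asymptotically equal.\<close>

lemma ratio_tendsto_1_interpolate:
  fixes r \<mu> :: "nat \<Rightarrow> real" and N \<kappa> :: "nat \<Rightarrow> nat"
  assumes r: "mono r" and \<mu>: "mono \<mu>" and pos: "\<And>k. 0 < \<mu> (N k)"
    and \<kappa>: "filterlim \<kappa> at_top sequentially"
    and N: "\<forall>\<^sub>F n in sequentially. N (\<kappa> n) \<le> n \<and> n \<le> N (Suc (\<kappa> n))"
    and lim: "(\<lambda>k. r (N k) / \<mu> (N k)) \<longlonglongrightarrow> 1" "(\<lambda>k. \<mu> (N (Suc k)) / \<mu> (N k)) \<longlonglongrightarrow> 1"
  shows "(\<lambda>n. r n / \<mu> n) \<longlonglongrightarrow> 1"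
proof -
  have "(\<lambda>k. (r (N k) / \<mu> (N k)) / (\<mu> (N (Suc k)) / \<mu> (N k))) \<longlonglongrightarrow> 1 / 1"
    by (intro tendsto_divide lim) simp
  then have lo: "(\<lambda>k. r (N k) / \<mu> (N (Suc k))) \<longlonglongrightarrow> 1"
    using pos by (simp add: less_imp_neq[OF pos, symmetric])
  have "(\<lambda>k. (r (N (Suc k)) / \<mu> (N (Suc k))) * (\<mu> (N (Suc k)) / \<mu> (N k))) \<longlonglongrightarrow> 1 * 1"
    by (intro tendsto_mult lim LIMSEQ_Suc)
  then have hi: "(\<lambda>k. r (N (Suc k)) / \<mu> (N k)) \<longlonglongrightarrow> 1"
    using pos by (simp add: less_imp_neq[OF pos, symmetric])
  \<comment> \<open>The sign of \<open>r\<close> is not given; positivity along the subsequence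
    comes from the limit and makes the fractions comparable.\<close>
  have r0: "\<forall>\<^sub>F k in sequentially. 0 < r (N k)"
  proof -
    have "0 < r (N k) / \<mu> (N k) \<longleftrightarrow> 0 < r (N k)" for k
      using pos[of k] by (simp add: zero_less_divide_iff)
    then show ?thesis
      using order_tendstoD(1)[OF lim(1), of 0] by simp
  qed
  have ev: "\<forall>\<^sub>F n in sequentially. r (N (\<kappa> n)) / \<mu> (N (Suc (\<kappa> n))) \<le> r n / \<mu> n
      \<and> r n / \<mu> n \<le> r (N (Suc (\<kappa> n))) / \<mu> (N (\<kappa> n))"
    using N filterlim_iff[THEN iffD1, OF \<kappa>, rule_format, OF r0]
  proof eventually_elim
    case (elim n)
    then have "r (N (\<kappa> n)) \<le> r n" "r n \<le> r (N (Suc (\<kappa> n)))"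
        "\<mu> (N (\<kappa> n)) \<le> \<mu> n" "\<mu> n \<le> \<mu> (N (Suc (\<kappa> n)))"
      using r \<mu> by (auto dest: monoD)
    with elim pos[of "\<kappa> n"] show ?case
      by (intro conjI frac_le) auto
  qed
  show ?thesis
  proof (rule tendsto_sandwich)
    show "(\<lambda>n. r (N (\<kappa> n)) / \<mu> (N (Suc (\<kappa> n)))) \<longlonglongrightarrow> 1"
      by (rule filterlim_compose[OF lo \<kappa>])
    show "(\<lambda>n. r (N (Suc (\<kappa> n))) / \<mu> (N (\<kappa> n))) \<longlonglongrightarrow> 1"
      by (rule filterlim_compose[OF hi \<kappa>])
  qed (use ev in \<open>auto elim: eventually_mono\<close>)
qed

text \<open>Chebyshev's inequality is summable along a subsequence on which the mean grows like the squares;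
  monotonicity fills the gaps.\<close>

lemma AE_R_asymp_mean:
  fixes D :: "nat pmf" and \<mu> :: "nat \<Rightarrow> real"
  assumes \<mu>: "\<And>n. (\<lambda>i. 1 - (1 - pmf D i) ^ n) sums \<mu> n"
    and mono: "mono \<mu>" and top: "filterlim \<mu> at_top sequentially"
    and Suc_le: "\<And>n. \<mu> (Suc n) \<le> \<mu> n + c"
  shows "AE \<omega> in stream_space (measure_pmf D). (\<lambda>n. real (R n \<omega>) / \<mu> n) \<longlonglongrightarrow> 1"
proof -
  let ?M = "stream_space (measure_pmf D)"
  interpret M: prob_space ?M
    by (intro prob_space.prob_space_stream_space prob_space_measure_pmf)
  \<comment> \<open>First time at which the mean reaches the square of \<open>Suc k\<close>: squares
    are sparse enough for Chebyshev to be summable and dense enough for consecutive ratios to tend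
    to 1.\<close>
  define N where "N k = (LEAST n. (real (Suc k))\<^sup>2 \<le> \<mu> n)" for k
  have ex: "\<exists>n. (real (Suc k))\<^sup>2 \<le> \<mu> n" for k
    using filterlim_at_top[THEN iffD1, OF top, rule_format, of "(real (Suc k))\<^sup>2"]
    by (auto simp: eventually_sequentially)
  have N_ge: "(real (Suc k))\<^sup>2 \<le> \<mu> (N k)" for k
    unfolding N_def using ex by (rule LeastI_ex)
  have \<mu>_0: "\<mu> 0 = 0"
    using \<mu>[of 0] by (simp add: sums_iff)
  \<comment> \<open>Just before time \<open>N k\<close> the mean is below the square, and one step
    adds at most \<open>c\<close>.\<close>
  have N_le: "\<mu> (N k) \<le> (real (Suc k))\<^sup>2 + c" for k
  proof (cases "N k")
    case 0
    then show ?thesis using N_ge[of k] \<mu>_0 by simp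
  next
    case (Suc m)
    then have "\<mu> m < (real (Suc k))\<^sup>2"
      unfolding N_def using not_less_Least[of m] by (metis lessI not_le)
    then show ?thesis using Suc_le[of m] Suc by simp
  qed
  have N_pos: "0 < \<mu> (N k)" for k
    using N_ge[of k] by (rule less_le_trans[rotated]) simp
  \<comment> \<open>The tolerances \<open>1 / Suc m\<close> form a countable family, so one null set
    serves all of them.\<close>
  have sub: "AE \<omega> in ?M. \<forall>m. \<forall>\<^sub>F k in sequentially.
      \<bar>real (R (N k) \<omega>) - \<mu> (N k)\<bar> < \<mu> (N k) / real (Suc m)"
    unfolding AE_all_countable
  proof
    fix m :: nat
    define E where "E k = {\<omega>. \<mu> (N k) / real (Suc m) \<le> \<bar>real (R (N k) \<omega>) - \<mu> (N k)\<bar>}" for k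
    have E [measurable]: "E k \<in> sets ?M" for k
      unfolding E_def R_def by (rule sets_stake_event)
    have le: "measure ?M (E k) \<le> (real (Suc m))\<^sup>2 / (real (Suc k))\<^sup>2" for k
    proof -
      have "measure ?M (E k) \<le> \<mu> (N k) / (\<mu> (N k) / real (Suc m))\<^sup>2"
        unfolding E_def by (rule R_tail_bound[OF \<mu>]) (simp add: N_pos)
      also have "\<dots> = (real (Suc m))\<^sup>2 / \<mu> (N k)"
        using N_pos[of k] by (simp add: power2_eq_square field_simps)
      also have "\<dots> \<le> (real (Suc m))\<^sup>2 / (real (Suc k))\<^sup>2"
        using N_ge[of k] by (intro divide_left_mono mult_pos_pos N_pos) auto
      finally show ?thesis .
    qed
    have "summable (\<lambda>k. (real (Suc m))\<^sup>2 * inverse ((real (Suc k))\<^sup>2))"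
      using inverse_power_summable[of 2, where 'a = real]
        summable_Suc_iff[of "\<lambda>k. inverse ((real k)\<^sup>2)"]
      by (intro summable_mult) (simp del: of_nat_Suc)
    then have "summable (\<lambda>k. measure ?M (E k))"
      by (rule summable_comparison_test'[where N = 0]) (use le in \<open>simp add: divide_inverse\<close>)
    then have "AE \<omega> in ?M. \<forall>\<^sub>F k in sequentially. \<omega> \<in> space ?M - E k"
      by (intro borel_cantelli_AE1 E) (simp_all add: M.emeasure_eq_measure)
    then show "AE \<omega> in ?M. \<forall>\<^sub>F k in sequentially.
        \<bar>real (R (N k) \<omega>) - \<mu> (N k)\<bar> < \<mu> (N k) / real (Suc m)"
      by eventually_elim (auto simp: E_def not_le elim: eventually_mono)
  qed
  \<comment> \<open>The squares are those of \<open>Suc k\<close>, hence the subtraction of 1: for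
    \<open>\<mu> n \<ge> 1\<close> this is the largest \<open>k\<close> with
    \<open>(real (Suc k))\<^sup>2 \<le> \<mu> n\<close>.\<close>
  define \<kappa> where "\<kappa> n = nat \<lfloor>sqrt (\<mu> n)\<rfloor> - 1" for n
  show ?thesis
    using sub
  proof eventually_elim
    case (elim \<omega>)
    show ?case
    proof (rule ratio_tendsto_1_interpolate[where N = N and \<kappa> = \<kappa>])
      show "mono (\<lambda>n. real (R n \<omega>))"
        by (intro monoI) (simp add: R_mono)
      show "filterlim \<kappa> at_top sequentially"
      proof -
        have "filterlim (\<lambda>x::real. nat \<lfloor>sqrt x\<rfloor> - 1) at_top at_top"
        proof -
          have 1: "filterlim (\<lambda>n::nat. n - 1) at_top at_top"
            using filterlim_minus_const_nat_at_top by blast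
          show ?thesis
            by (rule filterlim_compose[OF 1 filterlim_compose[OF filterlim_nat_sequentially
                filterlim_compose[OF filterlim_floor_sequentially sqrt_at_top]]])
        qed
        then show ?thesis
          unfolding \<kappa>_def by (rule filterlim_compose[OF _ top])
      qed
      show "\<forall>\<^sub>F n in sequentially. N (\<kappa> n) \<le> n \<and> n \<le> N (Suc (\<kappa> n))"
        using filterlim_at_top[THEN iffD1, OF top, rule_format, of 1]
      proof eventually_elim
        case (elim n)
        then have s: "1 \<le> sqrt (\<mu> n)" by simp
        then have "1 \<le> \<lfloor>sqrt (\<mu> n)\<rfloor>" by simp
        then have \<kappa>: "real (Suc (\<kappa> n)) = of_int \<lfloor>sqrt (\<mu> n)\<rfloor>"
          unfolding \<kappa>_def by (simp add: nat_diff_distrib of_nat_diff)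
        have "(real (Suc (\<kappa> n)))\<^sup>2 \<le> (sqrt (\<mu> n))\<^sup>2"
          unfolding \<kappa> using s by (intro power_mono) auto
        then have "(real (Suc (\<kappa> n)))\<^sup>2 \<le> \<mu> n" using elim by simp
        then have 1: "N (\<kappa> n) \<le> n" unfolding N_def by (rule Least_le)
        have "sqrt (\<mu> n) < real (Suc (Suc (\<kappa> n)))"
          unfolding of_nat_Suc[of "Suc (\<kappa> n)"] \<kappa> by linarith
        then have "(sqrt (\<mu> n))\<^sup>2 < (real (Suc (Suc (\<kappa> n))))\<^sup>2"
          using s by (intro power_strict_mono) auto
        also have "\<dots> \<le> \<mu> (N (Suc (\<kappa> n)))" by (rule N_ge)
        finally have "\<mu> n < \<mu> (N (Suc (\<kappa> n)))" using elim by simp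
        then have "n \<le> N (Suc (\<kappa> n))"
          using monoD[OF mono, of "N (Suc (\<kappa> n))" n] by (meson linorder_le_cases not_le)
        with 1 show ?case by simp
      qed
      show "(\<lambda>k. real (R (N k) \<omega>) / \<mu> (N k)) \<longlonglongrightarrow> 1"
      proof (rule tendstoI)
        fix e :: real assume "0 < e"
        then obtain m where m: "inverse (real (Suc m)) < e" using reals_Archimedean by blast
        show "\<forall>\<^sub>F k in sequentially. dist (real (R (N k) \<omega>) / \<mu> (N k)) 1 < e"
          using elim[rule_format, of m]
        proof eventually_elim
          case (elim k)
          have "real (R (N k) \<omega>) / \<mu> (N k) - 1 = (real (R (N k) \<omega>) - \<mu> (N k)) / \<mu> (N k)"
            using N_pos[of k] by (simp add: field_simps)
          then have "dist (real (R (N k) \<omega>) / \<mu> (N k)) 1 = \<bar>real (R (N k) \<omega>) - \<mu> (N k)\<bar> / \<mu> (N k)"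
            using N_pos[of k] by (simp add: dist_real_def abs_divide)
          also have "\<dots> < (\<mu> (N k) / real (Suc m)) / \<mu> (N k)"
            using elim N_pos by (intro divide_strict_right_mono) auto
          also have "\<dots> = inverse (real (Suc m))"
            using N_pos[of k] by (simp add: divide_inverse del: of_nat_Suc)
          finally show ?case using m by linarith
        qed
      qed
      show "(\<lambda>k. \<mu> (N (Suc k)) / \<mu> (N k)) \<longlonglongrightarrow> 1"
      proof (rule tendsto_sandwich[OF _ _ tendsto_const])
        have "\<mu> (N k) \<le> \<mu> (N (Suc k))" for k
        proof (intro monoD[OF mono])
          have "(real (Suc k))\<^sup>2 \<le> (real (Suc (Suc k)))\<^sup>2"
            by (intro power_mono) auto
          then have "(real (Suc k))\<^sup>2 \<le> \<mu> (N (Suc k))" using N_ge[of "Suc k"] by linarith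
          then show "N k \<le> N (Suc k)" unfolding N_def[of k] by (rule Least_le)
        qed
        then show "\<forall>\<^sub>F k in sequentially. 1 \<le> \<mu> (N (Suc k)) / \<mu> (N k)"
          using N_pos by (simp add: le_divide_eq)
        have "\<mu> (N (Suc k)) / \<mu> (N k) \<le> ((real (Suc (Suc k)))\<^sup>2 + c) / (real (Suc k))\<^sup>2" for k
          using N_le[of "Suc k"] N_ge[of k] N_pos[of "Suc k"]
          by (intro frac_le) auto
        then show "\<forall>\<^sub>F k in sequentially. \<mu> (N (Suc k)) / \<mu> (N k)
            \<le> ((real (Suc (Suc k)))\<^sup>2 + c) / (real (Suc k))\<^sup>2"
          by simp
        show "(\<lambda>k. ((real (Suc (Suc k)))\<^sup>2 + c) / (real (Suc k))\<^sup>2) \<longlonglongrightarrow> 1"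
          by real_asymp
      qed
    qed (use mono N_pos in auto)
  qed
qed

section \<open>Integration against the weight function\<close>

lemma finite_gap_right:
  fixes t :: real
  assumes "finite P" "t < b"
  obtains y where "t < y" "y < b" "{t<..y} \<inter> P = {}"
proof -
  let ?Q = "insert b {p \<in> P. t < p}"
  have "t < Min ?Q" using assms by (subst Min_gr_iff) auto
  then have y: "t < (t + Min ?Q) / 2" "(t + Min ?Q) / 2 < Min ?Q" by auto
  moreover have "Min ?Q \<le> b" using assms by (intro Min_le) auto
  moreover have "{t<..(t + Min ?Q) / 2} \<inter> P = {}"
  proof -
    have "Min ?Q \<le> p" if "p \<in> P" "t < p" for p using assms that by (intro Min_le) auto
    then show ?thesis using y(2) by force
  qed
  ultimately show thesis by (intro that) auto
qed

lemma finite_gap_left: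
  fixes t :: real
  assumes "finite P" "b < t"
  obtains y where "b < y" "y < t" "{y..<t} \<inter> P = {}"
proof -
  obtain y where y: "- t < y" "y < - b" "{- t<..y} \<inter> uminus ` P = {}"
    using finite_gap_right[of "uminus ` P" "- t" "- b"] assms by auto
  have "p \<notin> {- y..<t}" if "p \<in> P" for p
  proof
    assume "p \<in> {- y..<t}"
    then have "- p \<in> {- t<..y}" by auto
    moreover have "- p \<in> uminus ` P" using that by simp
    ultimately show False using y(3) by blast
  qed
  then show thesis using y(1,2) by (intro that[of "- y"]) auto
qed

context
  fixes S :: "real \<Rightarrow> real" and P :: "real set"
  assumes P: "finite P" "P \<subseteq> {0..1}" "0 \<in> P" "1 \<in> P"
    and S: "\<And>x y. 0 \<le> x \<Longrightarrow> x \<le> y \<Longrightarrow> y \<le> 1 \<Longrightarrow> {x..y} \<inter> P = {} \<Longrightarrow> S x = S y"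
begin

lemma step_const_on_gap:
  assumes "0 \<le> a" "b \<le> 1" "{a<..<b} \<inter> P = {}" "x \<in> {a<..<b}" "y \<in> {a<..<b}"
  shows "S x = S y"
proof -
  have *: "S x = S y" if "x \<le> y" "x \<in> {a<..<b}" "y \<in> {a<..<b}" for x y
  proof (rule S)
    have "{x..y} \<subseteq> {a<..<b}" using that by auto
    then show "{x..y} \<inter> P = {}" using assms(3) by auto
  qed (use that assms in auto)
  show ?thesis
    using *[of x y] *[of y x, symmetric] assms(4,5) linorder_linear by blast
qed

lemma step_tendsto_right_gap:
  assumes "0 \<le> a" "b \<le> 1" "{a<..<b} \<inter> P = {}" "x \<in> {a<..<b}"
  shows "(S \<longlongrightarrow> S x) (at_right a)"
proof (rule tendsto_eventually)
  have "a < b" using assms by auto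
  then show "\<forall>\<^sub>F y in at_right a. S y = S x"
    unfolding eventually_at_right_field
    by (intro exI[of _ b] conjI allI impI step_const_on_gap[OF assms(1-3) _ assms(4)]) auto
qed

lemma step_tendsto_left_gap:
  assumes "0 \<le> a" "b \<le> 1" "{a<..<b} \<inter> P = {}" "x \<in> {a<..<b}"
  shows "(S \<longlongrightarrow> S x) (at_left b)"
proof (rule tendsto_eventually)
  have "a < b" using assms by auto
  then show "\<forall>\<^sub>F y in at_left b. S y = S x"
    unfolding eventually_at_left_field
    by (intro exI[of _ a] conjI allI impI step_const_on_gap[OF assms(1-3) _ assms(4)]) auto
qed

text \<open>\<open>Lim\<close> is a definite description, so existence of the limit must be shown
  before the operator can be used in calculations.\<close>

lemma step_tendsto_right:
  assumes "0 \<le> t" "t < 1"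
  shows "(S \<longlongrightarrow> Lim (at_right t) S) (at_right t)"
proof -
  obtain y where y: "t < y" "y < 1" "{t<..y} \<inter> P = {}"
    using finite_gap_right[OF P(1) assms(2)] .
  have "{t<..<y} \<subseteq> {t<..y}" by auto
  with y(3) have gap: "{t<..<y} \<inter> P = {}" by blast
  have lim: "(S \<longlongrightarrow> S ((t + y) / 2)) (at_right t)"
    using assms y gap by (intro step_tendsto_right_gap[of _ y]) auto
  then show ?thesis
    unfolding tendsto_Lim[OF trivial_limit_at_right_real lim] .
qed

lemma step_tendsto_left:
  assumes "0 < t" "t \<le> 1"
  shows "(S \<longlongrightarrow> Lim (at_left t) S) (at_left t)"
proof -
  obtain y where y: "0 < y" "y < t" "{y..<t} \<inter> P = {}"
    using finite_gap_left[OF P(1) assms(1)] .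
  have "{y<..<t} \<subseteq> {y..<t}" by auto
  with y(3) have gap: "{y<..<t} \<inter> P = {}" by blast
  have lim: "(S \<longlongrightarrow> S ((y + t) / 2)) (at_left t)"
    using assms y gap by (intro step_tendsto_left_gap[of y]) auto
  then show ?thesis
    unfolding tendsto_Lim[OF trivial_limit_at_left_real lim] .
qed

text \<open>Telescoping: \<open>S\<close> is constant between neighbouring points \<open>q\<close>
  and \<open>p\<close>, so the left limit at \<open>p\<close> is the right limit at
  \<open>q\<close>, and \<open>jump S q\<close> leads to the left limit at \<open>q\<close>. The
  induction is on the number of points below \<open>p\<close>.\<close>

lemma step_left_limit_eq_sum_jumps:
  assumes "p \<in> P" "0 < p"
  shows "Lim (at_left p) S = S 0 + (\<Sum>t\<in>{t \<in> P. t < p}. jump S t)"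
  using assms
proof (induction "card {t \<in> P. t < p}" arbitrary: p rule: less_induct)
  case less
  define q where "q = Max {t \<in> P. t < p}"
  have fin: "finite {t \<in> P. t < p}" "{t \<in> P. t < p} \<noteq> {}" using P less.prems by auto
  then have q: "q \<in> P" "q < p" using Max_in[OF fin] by (auto simp: q_def)
  have le_q: "t \<le> q" if "t \<in> P" "t < p" for t
    using fin that by (auto simp: q_def)
  have q01: "0 \<le> q" "q < 1" "p \<le> 1" using q P less.prems by auto
  have gap: "{q<..<p} \<inter> P = {}" using le_q by force
  let ?m = "(q + p) / 2"
  have m: "?m \<in> {q<..<p}" using q by auto
  have "Lim (at_left p) S = S ?m"
    by (rule tendsto_Lim[OF trivial_limit_at_left_real step_tendsto_left_gap[OF q01(1,3) gap m]])
  moreover have "Lim (at_right q) S = S ?m"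
    by (rule tendsto_Lim[OF trivial_limit_at_right_real step_tendsto_right_gap[OF q01(1,3) gap m]])
  ultimately have eq: "Lim (at_left p) S = Lim (at_right q) S" by simp
  have ins: "{t \<in> P. t < p} = insert q {t \<in> P. t < q}"
    using q le_q by force
  show ?case
  proof (cases "q = 0")
    case True
    then have "{t \<in> P. t < q} = {}" using P by force
    with True have "{t \<in> P. t < p} = {0}" unfolding ins by (simp only:)
    \<comment> \<open>At 0 the jump is measured from the value \<open>S 0\<close> itself, which
      starts the telescoping.\<close>
    then show ?thesis using eq True by (simp add: jump_def)
  next
    case False
    have "{t \<in> P. t < q} \<subset> {t \<in> P. t < p}" unfolding ins by auto
    then have "card {t \<in> P. t < q} < card {t \<in> P. t < p}" using fin by (intro psubset_card_mono)
    then have "Lim (at_left q) S = S 0 + (\<Sum>t\<in>{t \<in> P. t < q}. jump S t)"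
      using less.hyps[of q] q q01 False by simp
    moreover have "jump S q = Lim (at_right q) S - Lim (at_left q) S"
      using False q01 by (simp add: jump_def)
    ultimately show ?thesis using eq ins fin P by simp
  qed
qed

text \<open>The point 1 closes the telescoping, since \<open>jump\<close> takes \<open>S 1\<close>
  as the right limit there.\<close>

lemma step_sum_jumps: "(\<Sum>t\<in>P. jump S t) = S 1 - S 0"
proof -
  have "P = insert 1 {t \<in> P. t < 1}" using P by force
  then have "(\<Sum>t\<in>P. jump S t) = (\<Sum>t\<in>insert 1 {t \<in> P. t < 1}. jump S t)"
    by (rule arg_cong)
  also have "\<dots> = jump S 1 + (\<Sum>t\<in>{t \<in> P. t < 1}. jump S t)"
    using P(1) by (subst sum.insert) auto
  finally have "(\<Sum>t\<in>P. jump S t) = jump S 1 + (\<Sum>t\<in>{t \<in> P. t < 1}. jump S t)" .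
  then show ?thesis
    using step_left_limit_eq_sum_jumps[of 1] P by (simp add: jump_def)
qed

lemma step_jump_eq_0:
  assumes "t \<in> {0<..<1} - P"
  shows "jump S t = 0"
proof -
  obtain y where y: "t < y" "y < 1" "{t<..y} \<inter> P = {}"
    using finite_gap_right[OF P(1), of t 1] assms by auto
  obtain x where x: "0 < x" "x < t" "{x..<t} \<inter> P = {}"
    using finite_gap_left[OF P(1), of 0 t] assms by auto
  have gap: "{x<..<y} \<inter> P = {}"
  proof -
    have "{x<..<y} \<subseteq> {x..<t} \<union> {t} \<union> {t<..y}" using x y by auto
    then show ?thesis using x(3) y(3) assms by blast
  qed
  have 1: "S z = S t" if "z \<in> {x<..<y}" for z
    using x y by (intro step_const_on_gap[OF _ _ gap that]) auto
  have lims: "(S \<longlongrightarrow> S t) (at_right t)" "(S \<longlongrightarrow> S t) (at_left t)"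
  proof -
    show "(S \<longlongrightarrow> S t) (at_right t)"
    proof (rule tendsto_eventually)
      show "\<forall>\<^sub>F z in at_right t. S z = S t"
        unfolding eventually_at_right_field by (rule exI[of _ y]) (use x y in \<open>auto intro!: 1\<close>)
    qed
    show "(S \<longlongrightarrow> S t) (at_left t)"
    proof (rule tendsto_eventually)
      show "\<forall>\<^sub>F z in at_left t. S z = S t"
        unfolding eventually_at_left_field by (rule exI[of _ x]) (use x y in \<open>auto intro!: 1\<close>)
    qed
  qed
  have "Lim (at_right t) S = S t" "Lim (at_left t) S = S t"
    by (rule tendsto_Lim[OF trivial_limit_at_right_real lims(1)],
        rule tendsto_Lim[OF trivial_limit_at_left_real lims(2)])
  then show ?thesis
    using assms by (simp add: jump_def)
qed

text \<open>Needed to see that adding \<open>S\<close> leaves derivatives off \<open>P\<close>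
  unchanged; a finite set is closed, so there is room around \<open>t\<close>.\<close>

lemma step_locally_const:
  assumes "t \<in> {0<..<1} - P"
  obtains e where "0 < e" "ball t e \<subseteq> {0<..<1} - P" "\<And>x. x \<in> ball t e \<Longrightarrow> S x = S t"
proof -
  have "open ({0<..<1} - P)"
    by (rule open_Diff[OF open_greaterThanLessThan finite_imp_closed[OF P(1)]])
  then have "\<exists>e>0. ball t e \<subseteq> {0<..<1} - P"
    using assms by (simp only: open_contains_ball)
  then obtain e where e: "0 < e" "ball t e \<subseteq> {0<..<1} - P"
    by (elim exE conjE)
  have "S x = S t" if "x \<in> ball t e" for x
  proof (rule step_const_on_gap[of "t - e" "t + e"])
    have eq: "ball t e = {t - e<..<t + e}" by (simp add: ball_eq_greaterThanLessThan)
    show "{t - e<..<t + e} \<inter> P = {}" using e eq by auto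
    have "{t - e<..<t + e} \<subseteq> {0<..<1}" using e eq by auto
    then show "0 \<le> t - e" "t + e \<le> 1" using e(1) by (auto simp: greaterThanLessThan_subseteq_greaterThanLessThan)
    show "x \<in> {t - e<..<t + e}" "t \<in> {t - e<..<t + e}" using that eq e(1) by auto
  qed
  with e that show thesis by blast
qed

end

text \<open>On each of the finitely many pieces the derivative is the restriction of a function
  continuous on a compact interval, hence bounded there.\<close>

lemma piecewise_C1_01_deriv:
  assumes "piecewise_C1_01 C"
  obtains P B where "finite P" "P \<subseteq> {0..1}" "0 \<in> P" "1 \<in> P"
    "\<And>t. t \<in> {0<..<1} - P \<Longrightarrow> (C has_real_derivative deriv C t) (at t)"
    "continuous_on ({0<..<1} - P) (deriv C)" "\<And>t. t \<in> {0<..<1} - P \<Longrightarrow> \<bar>deriv C t\<bar> \<le> B"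
proof -
  from assms obtain P where P: "finite P" "P \<subseteq> {0..1}" "0 \<in> P" "1 \<in> P"
    and piece: "\<forall>a\<in>P. \<forall>b\<in>P. a < b \<and> {a<..<b} \<inter> P = {} \<longrightarrow>
           (\<exists>g g'. continuous_on {a..b} g' \<and>
              (\<forall>x\<in>{a..b}. (g has_real_derivative g' x) (at x within {a..b})) \<and>
              (\<forall>x\<in>{a<..<b}. C x = g x))"
    unfolding piecewise_C1_01_def by (elim conjE exE) (rule that)
  have local: "\<exists>g' B. continuous_on {a..b} g' \<and> (\<forall>t\<in>{a<..<b}. (C has_real_derivative g' t) (at t)) \<and>
      (\<forall>t\<in>{a<..<b}. \<bar>g' t\<bar> \<le> B)" if ab: "a \<in> P" "b \<in> P" "a < b \<and> {a<..<b} \<inter> P = {}" for a b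
  proof -
    from piece[rule_format, OF ab] obtain g g' where g: "continuous_on {a..b} g'"
      "\<And>x. x \<in> {a..b} \<Longrightarrow> (g has_real_derivative g' x) (at x within {a..b})"
      "\<And>x. x \<in> {a<..<b} \<Longrightarrow> C x = g x" by blast
    have "bounded (g' ` {a..b})"
      by (intro compact_imp_bounded compact_continuous_image g) auto
    then obtain B where "\<forall>y\<in>g' ` {a..b}. \<bar>y\<bar> \<le> B"
      unfolding bounded_real by blast
    then have B: "\<And>t. t \<in> {a..b} \<Longrightarrow> \<bar>g' t\<bar> \<le> B"
      by simp
    have "(C has_real_derivative g' t) (at t)" if t: "t \<in> {a<..<b}" for t
    proof -
      have "(g has_real_derivative g' t) (at t)"
        using g(2)[of t] t by (simp add: at_within_Icc_at)
      then show ?thesis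
        by (rule has_field_derivative_transform_within_open[of _ _ _ "{a<..<b}"])
           (use t g(3) in auto)
    qed
    with g(1) B show ?thesis by (intro exI[of _ g'] exI[of _ B]) auto
  qed
  \<comment> \<open>The piece containing \<open>t\<close> is cut out by the nearest points of
    \<open>P\<close> on either side.\<close>
  have gap: "\<exists>a\<in>P. \<exists>b\<in>P. (a < b \<and> {a<..<b} \<inter> P = {}) \<and> t \<in> {a<..<b}" if t: "t \<in> {0<..<1} - P" for t
  proof -
    define a where "a = Max {p \<in> P. p < t}"
    define b where "b = Min {p \<in> P. t < p}"
    have fin: "finite {p \<in> P. p < t}" "{p \<in> P. p < t} \<noteq> {}" "finite {p \<in> P. t < p}" "{p \<in> P. t < p} \<noteq> {}"
      using P t by auto
    have a: "a \<in> P" "a < t" using Max_in[OF fin(1,2)] by (auto simp: a_def)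
    have b: "b \<in> P" "t < b" using Min_in[OF fin(3,4)] by (auto simp: b_def)
    have "p \<notin> {a<..<b}" if p: "p \<in> P" for p
    proof -
      consider "p < t" | "t < p" | "p = t" by linarith
      then show ?thesis
      proof cases
        case 1
        then have "p \<le> a" unfolding a_def using fin p by (intro Max_ge) auto
        then show ?thesis by simp
      next
        case 2
        then have "b \<le> p" unfolding b_def using fin p by (intro Min_le) auto
        then show ?thesis by simp
      qed (use t p in auto)
    qed
    then have "{a<..<b} \<inter> P = {}" by blast
    with a b show ?thesis by (intro bexI[of _ a] bexI[of _ b]) auto
  qed
  define G where "G = {ab \<in> P \<times> P. fst ab < snd ab \<and> {fst ab<..<snd ab} \<inter> P = {}}"
  have "finite G" unfolding G_def using P by auto
  \<comment> \<open>Stated for \<open>deriv C\<close>, the bounds do not depend on the choice of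
    \<open>g'\<close>; the sum of their absolute values over \<open>G\<close> will be the common
    bound.\<close>
  have "\<forall>ab\<in>G. \<exists>B. \<forall>t\<in>{fst ab<..<snd ab}. \<bar>deriv C t\<bar> \<le> B"
  proof
    fix ab assume "ab \<in> G"
    then have "fst ab \<in> P" "snd ab \<in> P" "fst ab < snd ab \<and> {fst ab<..<snd ab} \<inter> P = {}"
      unfolding G_def by auto
    from local[OF this] obtain g' B where
        "\<forall>t\<in>{fst ab<..<snd ab}. (C has_real_derivative g' t) (at t)"
        "\<forall>t\<in>{fst ab<..<snd ab}. \<bar>g' t\<bar> \<le> B"
      by (elim exE conjE) (rule that)
    then show "\<exists>B. \<forall>t\<in>{fst ab<..<snd ab}. \<bar>deriv C t\<bar> \<le> B"
      by (intro exI[of _ B]) (auto simp: DERIV_imp_deriv)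
  qed
  from bchoice[OF this] obtain \<beta> where \<beta>: "\<forall>ab\<in>G. \<forall>t\<in>{fst ab<..<snd ab}. \<bar>deriv C t\<bar> \<le> \<beta> ab"
    by (elim exE) (rule that)
  show thesis
  proof (rule that[OF P])
    fix t assume t: "t \<in> {0<..<1} - P"
    obtain a b where ab: "a \<in> P" "b \<in> P" "a < b \<and> {a<..<b} \<inter> P = {}" "t \<in> {a<..<b}"
      using gap[OF t] by blast
    then obtain g' where g': "(C has_real_derivative g' t) (at t)"
      using local[OF ab(1-3)] by blast
    then show "(C has_real_derivative deriv C t) (at t)"
      unfolding DERIV_imp_deriv[OF g'] .
    have G: "(a, b) \<in> G" using ab by (auto simp: G_def)
    have "\<bar>deriv C t\<bar> \<le> \<beta> (a, b)" using bspec[OF \<beta> G] ab(4) by simp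
    also have "\<dots> \<le> \<bar>\<beta> (a, b)\<bar>" by simp
    also have "\<dots> \<le> (\<Sum>ab\<in>G. \<bar>\<beta> ab\<bar>)"
      using \<open>finite G\<close> G by (intro member_le_sum) auto
    finally show "\<bar>deriv C t\<bar> \<le> (\<Sum>ab\<in>G. \<bar>\<beta> ab\<bar>)" .
  next
    show "continuous_on ({0<..<1} - P) (deriv C)"
    proof (rule continuous_at_imp_continuous_on, rule ballI)
      fix t assume t: "t \<in> {0<..<1} - P"
      obtain a b where ab: "a \<in> P" "b \<in> P" "a < b \<and> {a<..<b} \<inter> P = {}" "t \<in> {a<..<b}"
        using gap[OF t] by blast
      then obtain g' where g': "continuous_on {a..b} g'"
          "\<And>t. t \<in> {a<..<b} \<Longrightarrow> (C has_real_derivative g' t) (at t)"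
        using local[OF ab(1-3)] by blast
      have "continuous_on {a<..<b} g'"
        by (rule continuous_on_subset[OF g'(1)]) auto
      then have "continuous_on {a<..<b} (deriv C)"
        using g'(2) by (subst continuous_on_cong[OF refl, of _ _ g']) (auto simp: DERIV_imp_deriv)
      then show "isCont (deriv C) t"
        using ab(4) by (simp add: continuous_on_eq_continuous_at)
    qed
  qed
qed

text \<open>Over a common partition the summands separate: \<open>C\<close> is continuous, so all
  jumps come from \<open>S\<close>; \<open>S\<close> is locally constant, so the density comes from
  \<open>C\<close>. Adding the telescoped jumps to the fundamental theorem for \<open>C\<close>
  gives the total mass of \<open>dA\<close>.\<close>

lemma weight_structure:
  assumes "\<exists>S C. step_fun_01 S \<and> piecewise_C1_01 C \<and> (\<forall>t\<in>{0..1}. A t = S t + C t)"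
  obtains P B I where "finite P" "P \<subseteq> {0..1}" "{t \<in> {0..1}. jump A t \<noteq> 0} \<subseteq> P"
    "continuous_on ({0<..<1} - P) (deriv A)" "\<And>t. t \<in> {0<..<1} - P \<Longrightarrow> \<bar>deriv A t\<bar> \<le> B"
    "(deriv A has_integral I) {0..1}" "(\<Sum>t\<in>P. jump A t) + I = A 1 - A 0"
proof -
  from assms obtain S C where S: "step_fun_01 S" and C: "piecewise_C1_01 C"
    and A: "\<And>t. t \<in> {0..1} \<Longrightarrow> A t = S t + C t"
    by (elim exE conjE) auto
  obtain P1 where P1: "finite P1" "P1 \<subseteq> {0..1}"
    and S1: "\<forall>x y. 0 \<le> x \<and> x \<le> y \<and> y \<le> 1 \<and> {x..y} \<inter> P1 = {} \<longrightarrow> S x = S y"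
    using S unfolding step_fun_01_def by (elim conjE exE) (rule that)
  obtain P2 B where P2: "finite P2" "P2 \<subseteq> {0..1}" "0 \<in> P2" "1 \<in> P2"
    and C2: "\<And>t. t \<in> {0<..<1} - P2 \<Longrightarrow> (C has_real_derivative deriv C t) (at t)"
      "continuous_on ({0<..<1} - P2) (deriv C)" "\<And>t. t \<in> {0<..<1} - P2 \<Longrightarrow> \<bar>deriv C t\<bar> \<le> B"
    by (rule piecewise_C1_01_deriv[OF C], rule that)
  define P where "P = P1 \<union> P2"
  have P: "finite P" "P \<subseteq> {0..1}" "0 \<in> P" "1 \<in> P"
    using P1 P2 by (auto simp: P_def)
  have SP: "S x = S y" if "0 \<le> x" "x \<le> y" "y \<le> 1" "{x..y} \<inter> P = {}" for x y
    using that by (intro S1[rule_format]) (auto simp: P_def)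
  have contC: "continuous_on {0..1} C"
    using C by (simp add: piecewise_C1_01_def)
  have Aright: "Lim (at_right t) A = Lim (at_right t) S + C t" if t: "0 \<le> t" "t < 1" for t
  proof (rule tendsto_Lim[OF trivial_limit_at_right_real])
    have "(C \<longlongrightarrow> C t) (at t within {t..1})"
      by (rule tendsto_within_subset[of _ _ _ "{0..1}"]) (use contC t in \<open>auto simp: continuous_on\<close>)
    then have "(C \<longlongrightarrow> C t) (at_right t)"
      using t by (simp add: at_within_Icc_at_right)
    then have lim: "((\<lambda>x. S x + C x) \<longlongrightarrow> Lim (at_right t) S + C t) (at_right t)"
      by (intro tendsto_add step_tendsto_right[OF P SP t])
    have "\<forall>\<^sub>F x in at_right t. S x + C x = A x"
      unfolding eventually_at_right_field
      by (rule exI[of _ 1]) (use t in \<open>auto intro!: A[symmetric]\<close>)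
    with lim show "(A \<longlongrightarrow> Lim (at_right t) S + C t) (at_right t)"
      by (rule Lim_transform_eventually)
  qed
  have Aleft: "Lim (at_left t) A = Lim (at_left t) S + C t" if t: "0 < t" "t \<le> 1" for t
  proof (rule tendsto_Lim[OF trivial_limit_at_left_real])
    have "(C \<longlongrightarrow> C t) (at t within {0..t})"
      by (rule tendsto_within_subset[of _ _ _ "{0..1}"]) (use contC t in \<open>auto simp: continuous_on\<close>)
    then have "(C \<longlongrightarrow> C t) (at_left t)"
      using t by (simp add: at_within_Icc_at_left)
    then have lim: "((\<lambda>x. S x + C x) \<longlongrightarrow> Lim (at_left t) S + C t) (at_left t)"
      by (intro tendsto_add step_tendsto_left[OF P SP t])
    have "\<forall>\<^sub>F x in at_left t. S x + C x = A x"
      unfolding eventually_at_left_field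
      by (rule exI[of _ 0]) (use t in \<open>auto intro!: A[symmetric]\<close>)
    with lim show "(A \<longlongrightarrow> Lim (at_left t) S + C t) (at_left t)"
      by (rule Lim_transform_eventually)
  qed
  have jump: "jump A t = jump S t" if "t \<in> {0..1}" for t
    unfolding jump_def using that Aright[of t] Aleft[of t] A[of t] by auto
  have DA: "(A has_real_derivative deriv C t) (at t)" if t: "t \<in> {0<..<1} - P" for t
  proof -
    obtain e where e: "0 < e" "ball t e \<subseteq> {0<..<1} - P" "\<And>x. x \<in> ball t e \<Longrightarrow> S x = S t"
      by (rule step_locally_const[OF P SP t], assumption, assumption, assumption, assumption, rule that)
    have "((\<lambda>x. S t + C x) has_real_derivative deriv C t) (at t)"
      using DERIV_add[OF DERIV_const[of "S t"] C2(1)[of t]] t by (simp add: P_def)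
    then show ?thesis
    proof (rule has_field_derivative_transform_within_open[of _ _ _ "ball t e"])
      fix x assume x: "x \<in> ball t e"
      then have "x \<in> {0..1}" using e(2) by fastforce
      then show "S t + C x = A x" using A[of x] e(3)[OF x] by simp
    qed (use e(1) in auto)
  qed
  have derivA: "deriv A t = deriv C t" if "t \<in> {0<..<1} - P" for t
    using DA[OF that] by (rule DERIV_imp_deriv)
  show thesis
  proof (rule that[OF P(1,2)])
    show "{t \<in> {0..1}. jump A t \<noteq> 0} \<subseteq> P"
    proof (rule subsetI, rule ccontr)
      fix t assume t: "t \<in> {t \<in> {0..1}. jump A t \<noteq> 0}" "t \<notin> P"
      then have "t \<noteq> 0" "t \<noteq> 1" using P by auto
      then have "t \<in> {0<..<1} - P" using t by auto
      then show False using step_jump_eq_0[OF P SP] jump t by simp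
    qed
    show "continuous_on ({0<..<1} - P) (deriv A)"
      using continuous_on_subset[OF C2(2), of "{0<..<1} - P"]
      by (subst continuous_on_cong[OF refl derivA]) (auto simp: P_def)
    show "\<bar>deriv A t\<bar> \<le> B" if "t \<in> {0<..<1} - P" for t
      using C2(3)[of t] derivA[OF that] that by (simp add: P_def)
    show "(deriv A has_integral C 1 - C 0) {0..1}"
    proof (rule fundamental_theorem_of_calculus_interior_strong[OF P(1)])
      fix t assume t: "t \<in> {0<..<1} - P"
      show "(C has_vector_derivative deriv A t) (at t)"
        using C2(1)[of t] t derivA[OF t]
        by (simp add: P_def has_real_derivative_iff_has_vector_derivative)
    qed (use contC in auto)
    have "(\<Sum>t\<in>P. jump A t) = (\<Sum>t\<in>P. jump S t)"
      using P by (intro sum.cong) (auto intro!: jump)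
    then show "(\<Sum>t\<in>P. jump A t) + (C 1 - C 0) = A 1 - A 0"
      using step_sum_jumps[OF P SP] A[of 0] A[of 1] by simp
  qed
qed

text \<open>Provides the integrable envelope for dominated convergence. The antiderivative
  \<open>t * ln t - t\<close> is continuous at 0, where its HOL value is the limit 0.\<close>

lemma has_integral_ln_01: "(ln has_integral - 1) {0..1::real}"
proof -
  have "continuous_on {0..1} (\<lambda>t::real. t * ln t - t)"
    unfolding continuous_on
  proof
    fix t :: real assume t: "t \<in> {0..1}"
    show "((\<lambda>t. t * ln t - t) \<longlongrightarrow> t * ln t - t) (at t within {0..1})"
    proof (cases "t = 0")
      case True
      have "((\<lambda>t::real. t * ln t - t) \<longlongrightarrow> 0) (at_right 0)" by real_asymp
      then show ?thesis using True by (simp add: at_within_Icc_at_right)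
    next
      case False
      then show ?thesis using t by (auto intro!: tendsto_intros)
    qed
  qed
  moreover have "((\<lambda>t. t * ln t - t) has_vector_derivative ln t) (at t)" if "t \<in> {0<..<1} - {}" for t :: real
    using that unfolding has_real_derivative_iff_has_vector_derivative[symmetric]
    by (auto intro!: derivative_eq_intros)
  ultimately have "(ln has_integral (1 * ln 1 - 1) - (0 * ln 0 - 0)) {0..1::real}"
    by (intro fundamental_theorem_of_calculus_interior_strong[of "{}"]) auto
  then show ?thesis by simp
qed

text \<open>Since \<open>dA\<close> has total mass zero, subtracting the constant \<open>c n\<close>
  does not change the integral. The jumps give a finite sum, and as the density is bounded, a
  multiple of \<open>K - ln t\<close> dominates the rest.\<close>

lemma LS_integral_tendsto:
  fixes F :: "nat \<Rightarrow> real \<Rightarrow> real" and c :: "nat \<Rightarrow> real"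
  assumes decomp: "\<exists>S C. step_fun_01 S \<and> piecewise_C1_01 C \<and> (\<forall>t\<in>{0..1}. A t = S t + C t)"
    and A01: "A 0 = A 1" and jump0: "jump A 0 = 0"
    and meas: "\<And>n. F n \<in> borel_measurable borel"
    and lim: "\<And>t. t \<in> {0<..1} \<Longrightarrow> (\<lambda>n. F n t - c n) \<longlonglongrightarrow> \<theta> * ln t"
    and bound: "\<And>n t. t \<in> {0<..1} \<Longrightarrow> \<bar>F n t - c n\<bar> \<le> K - ln t"
  shows "(\<lambda>n. LS_integral (F n) A) \<longlonglongrightarrow> \<theta> * LS_integral ln A"
proof -
  obtain P B I where P: "finite P" "P \<subseteq> {0..1}" and JP: "{t \<in> {0..1}. jump A t \<noteq> 0} \<subseteq> P"
    and cont: "continuous_on ({0<..<1} - P) (deriv A)"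
    and B: "\<And>t. t \<in> {0<..<1} - P \<Longrightarrow> \<bar>deriv A t\<bar> \<le> B"
    and I: "(deriv A has_integral I) {0..1}" and total: "(\<Sum>t\<in>P. jump A t) + I = A 1 - A 0"
    by (rule weight_structure[OF decomp], rule that)
  define J where "J = {t \<in> {0..1}. jump A t \<noteq> 0}"
  \<comment> \<open>Absence of a jump at 0 matters: convergence and bound for \<open>F n\<close> are
    given only for positive \<open>t\<close>.\<close>
  have J: "finite J" "J \<subseteq> {0<..1}"
    using JP P(1) jump0 by (auto simp: J_def finite_subset less_le)
  have "(\<Sum>t\<in>P. jump A t) = (\<Sum>t\<in>J. jump A t)"
    using P JP by (intro sum.mono_neutral_right) (auto simp: J_def)
  with total A01 have total_J: "(\<Sum>t\<in>J. jump A t) + I = 0" by simp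
  \<comment> \<open>This leaves out finitely many points of [0,1], at which nothing is known about
    \<open>deriv A\<close>.\<close>
  define U where "U = {0<..<1::real} - P"
  have U: "U \<subseteq> {0..1}" by (auto simp: U_def)
  have "open U" unfolding U_def by (rule open_Diff[OF open_greaterThanLessThan finite_imp_closed[OF P(1)]])
  then have U_sets: "U \<in> sets lebesgue" by simp
  have "{0..1} - U \<subseteq> insert 0 (insert 1 P)" by (auto simp: U_def)
  then have negl: "negligible ({0..1} - U)" using P(1) by (meson finite_insert finite_subset negligible_finite)
  have int_U: "f integrable_on U \<longleftrightarrow> f integrable_on {0..1}" "integral U f = integral {0..1} f"
    for f :: "real \<Rightarrow> real"
  proof -
    have e: "negligible {x \<in> U - {0..1}. f x \<noteq> 0}" "negligible {x \<in> {0..1} - U. f x \<noteq> 0}"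
      using U by (auto intro: negligible_subset[OF negl] simp: Diff_eq_empty_iff[THEN iffD2])
    show "f integrable_on U \<longleftrightarrow> f integrable_on {0..1}"
      using integrable_spike_set[OF _ e] integrable_spike_set[OF _ e(2,1)] by blast
    show "integral U f = integral {0..1} f"
      by (rule integral_spike_set[OF e])
  qed
  define h where "h t = (K - ln t) * \<bar>B\<bar>" for t :: real
  have h: "h integrable_on U"
  proof -
    have "ln integrable_on {0..1::real}" using has_integral_ln_01 by blast
    then have "(\<lambda>t. (K - ln t) * \<bar>B\<bar>) integrable_on {0..1}"
      by (intro integrable_on_mult_left integrable_diff) auto
    then show ?thesis unfolding int_U h_def .
  qed
  have measA: "deriv A \<in> borel_measurable (lebesgue_on U)"
    using cont U_sets by (intro continuous_imp_measurable_on_sets_lebesgue) (auto simp: U_def)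
  define g where "g n t = (F n t - c n) * deriv A t" for n t
  have g_le: "norm (g n t) \<le> h t" if t: "t \<in> U" for n t
  proof -
    have t01: "t \<in> {0<..1}" using t by (auto simp: U_def)
    have "\<bar>deriv A t\<bar> \<le> \<bar>B\<bar>" using B[of t] t by (auto simp: U_def)
    then show ?thesis
      unfolding g_def h_def real_norm_def abs_mult
      using bound[OF t01, of n] by (intro mult_mono) auto
  qed
  have g_int: "g n integrable_on U" for n
  proof (rule measurable_bounded_by_integrable_imp_integrable[OF _ h g_le U_sets])
    have "F n \<in> borel_measurable (lebesgue_on U)"
      using meas[of n] by (intro measurable_restrict_space1 measurable_completion) simp
    then show "g n \<in> borel_measurable (lebesgue_on U)"
      unfolding g_def using measA by (intro borel_measurable_times borel_measurable_diff) auto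
  qed
  have conv: "(\<lambda>n. integral U (g n)) \<longlonglongrightarrow> integral U (\<lambda>t. \<theta> * ln t * deriv A t)"
  proof (rule dominated_convergence(2)[OF g_int h g_le])
    fix t assume "t \<in> U"
    then have "t \<in> {0<..1}" by (auto simp: U_def)
    then show "(\<lambda>n. g n t) \<longlonglongrightarrow> \<theta> * ln t * deriv A t"
      unfolding g_def by (intro tendsto_intros lim)
  qed
  have LS: "LS_integral (F n) A = (\<Sum>t\<in>J. (F n t - c n) * jump A t) + integral U (g n)" for n
  proof -
    have A_int: "deriv A integrable_on U" "integral U (deriv A) = I"
      using I by (auto simp: int_U)
    have "integral {0..1} (\<lambda>t. F n t * deriv A t) = integral U (\<lambda>t. g n t + c n * deriv A t)"
      unfolding int_U g_def by (simp add: algebra_simps)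
    also have "\<dots> = integral U (g n) + c n * I"
      using g_int A_int
      by (subst Henstock_Kurzweil_Integration.integral_add) (auto intro!: integrable_on_mult_right)
    finally have "LS_integral (F n) A = (\<Sum>t\<in>J. F n t * jump A t) + (integral U (g n) + c n * I)"
      by (simp add: LS_integral_def J_def)
    also have "(\<Sum>t\<in>J. F n t * jump A t) = (\<Sum>t\<in>J. (F n t - c n) * jump A t) + c n * (\<Sum>t\<in>J. jump A t)"
    proof -
      have "(\<Sum>t\<in>J. F n t * jump A t) = (\<Sum>t\<in>J. (F n t - c n) * jump A t + c n * jump A t)"
        by (intro sum.cong) (simp_all add: algebra_simps)
      then show ?thesis by (simp only: sum.distrib sum_distrib_left)
    qed
    \<comment> \<open>The two terms with \<open>c n\<close> cancel because they add up to
      \<open>c n\<close> times the total mass.\<close>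
    finally show ?thesis
      using arg_cong[OF total_J, of "\<lambda>x. c n * x"] by (simp add: algebra_simps)
  qed
  have "(\<lambda>n. (\<Sum>t\<in>J. (F n t - c n) * jump A t) + integral U (g n))
      \<longlonglongrightarrow> (\<Sum>t\<in>J. \<theta> * ln t * jump A t) + integral U (\<lambda>t. \<theta> * ln t * deriv A t)"
    using J by (intro tendsto_add tendsto_sum tendsto_mult tendsto_const lim conv) auto
  also have "(\<Sum>t\<in>J. \<theta> * ln t * jump A t) + integral U (\<lambda>t. \<theta> * ln t * deriv A t) = \<theta> * LS_integral ln A"
    unfolding LS_integral_def J_def[symmetric] int_U
    by (simp add: sum_distrib_left distrib_left mult.assoc)
  finally show ?thesis unfolding LS .
qed

section \<open>Consistency of the estimator\<close>

lemma summable_pmf_nat: "summable (pmf (D :: nat pmf))"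
  using pmf_abs_summable[of D UNIV] by (simp add: abs_summable_on_nat_iff')

context positive_rates
begin

text \<open>By concavity \<open>occ_mean q x / x\<close> is nonincreasing. This yields the
  coefficient 1 of \<open>- ln t\<close> in the dominating bound.\<close>

lemma ln_occ_mean_diff_le:
  assumes "0 < x" "x \<le> y"
  shows "ln (occ_mean q y) - ln (occ_mean q x) \<le> ln y - ln x"
proof -
  have "occ_mean q y \<le> y / x * occ_mean q x"
    using occ_mean_scale_le[of x "y / x"] assms by simp
  then have "ln (occ_mean q y) \<le> ln (y / x * occ_mean q x)"
    using assms occ_mean_pos by (subst ln_le_cancel_iff) auto
  also have "\<dots> = ln y - ln x + ln (occ_mean q x)"
    using assms occ_mean_pos[of x] by (simp add: ln_mult ln_div)
  finally show ?thesis by simp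
qed

section \<open>Deterministic analysis along one sample path \<open>\<rho>\<close> of
  \<open>R\<close>\<close>

context
  fixes \<rho> :: "nat \<Rightarrow> nat"
  assumes \<rho>_mono: "\<And>m n. m \<le> n \<Longrightarrow> \<rho> m \<le> \<rho> n"
    and \<rho>_pos: "\<And>n. 1 \<le> n \<Longrightarrow> 1 \<le> \<rho> n" and \<rho>_le: "\<And>n. \<rho> n \<le> n"
    and \<rho>_asymp: "(\<lambda>n. real (\<rho> n) / occ_mean q (real n)) \<longlonglongrightarrow> 1"
begin

lemma logp_\<rho>: "1 \<le> n \<Longrightarrow> logp (real (\<rho> n)) = ln (real (\<rho> n))"
  using \<rho>_pos[of n] by (simp add: logp_def)

text \<open>With \<open>m = [n t]\<close>, the ratio \<open>\<rho> m / \<rho> n\<close> factors into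
  path over mean at \<open>m\<close> and at \<open>n\<close>, mean at \<open>m\<close> over mean at
  \<open>n * t\<close>, and mean at \<open>n * t\<close> over mean at \<open>n\<close>. Only the
  last factor has a limit other than 1 in general, namely \<open>t powr \<theta>\<close>.\<close>

lemma log_increment_tendsto:
  assumes rv: "((\<lambda>x. occ_mean q (t * x) / occ_mean q x) \<longlongrightarrow> t powr \<theta>) at_top"
    and t: "0 < t" "t \<le> 1"
  shows "(\<lambda>n. logp (real (\<rho> (nat \<lfloor>real n * t\<rfloor>))) - ln (real (\<rho> n))) \<longlonglongrightarrow> \<theta> * ln t"
proof -
  define m where "m n = nat \<lfloor>real n * t\<rfloor>" for n
  have m_real: "real (m n) = of_int \<lfloor>real n * t\<rfloor>" for n
    using t by (simp add: m_def)
  have m_top: "filterlim m at_top sequentially"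
  proof -
    have "filterlim (\<lambda>n. real n * t) at_top sequentially" using t by real_asymp
    then show ?thesis
      unfolding m_def
      by (intro filterlim_compose[OF filterlim_nat_sequentially]
          filterlim_compose[OF filterlim_floor_sequentially])
  qed
  have m_div: "(\<lambda>n. real (m n) / (real n * t)) \<longlonglongrightarrow> 1"
    unfolding m_real using t by real_asymp
  have m_ge: "\<forall>\<^sub>F n in sequentially. 1 \<le> m n \<and> 1 \<le> n"
    using filterlim_at_top[THEN iffD1, OF m_top, rule_format, of 1] eventually_ge_at_top[of 1]
    by eventually_elim simp
  \<comment> \<open>Rounding down is harmless: concavity bounds the ratio below by
    \<open>real (m n) / (real n * t)\<close>, monotonicity above by 1.\<close>
  have 1: "(\<lambda>n. occ_mean q (real (m n)) / occ_mean q (real n * t)) \<longlonglongrightarrow> 1"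
  proof (rule tendsto_sandwich[OF _ _ m_div tendsto_const])
    show "\<forall>\<^sub>F n in sequentially. real (m n) / (real n * t) \<le> occ_mean q (real (m n)) / occ_mean q (real n * t)"
      using m_ge
    proof eventually_elim
      case (elim n)
      have le: "real (m n) \<le> real n * t" unfolding m_real by simp
      have pos: "0 < real (m n)" "0 < real n * t" using elim t by auto
      have "occ_mean q (real n * t / real (m n) * real (m n)) \<le> real n * t / real (m n) * occ_mean q (real (m n))"
        using le pos by (intro occ_mean_scale_le) (auto simp: le_divide_eq)
      then show ?case
        using pos occ_mean_pos[OF pos(2)] by (simp add: field_simps)
    qed
    show "\<forall>\<^sub>F n in sequentially. occ_mean q (real (m n)) / occ_mean q (real n * t) \<le> 1"
      using m_ge
    proof eventually_elim
      case (elim n)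
      have "0 < real n * t" using elim t by simp
      moreover have "real (m n) \<le> real n * t" unfolding m_real by simp
      ultimately show ?case
        using occ_mean_mono[of "real (m n)" "real n * t"] occ_mean_pos[of "real n * t"] by simp
    qed
  qed
  have 2: "(\<lambda>n. occ_mean q (real n * t) / occ_mean q (real n)) \<longlonglongrightarrow> t powr \<theta>"
    using filterlim_compose[OF rv filterlim_real_sequentially] by (simp add: mult.commute)
  have 3: "(\<lambda>n. real (\<rho> (m n)) / occ_mean q (real (m n))) \<longlonglongrightarrow> 1"
    by (rule filterlim_compose[OF \<rho>_asymp m_top])
  have "(\<lambda>n. (real (\<rho> (m n)) / occ_mean q (real (m n))) * (occ_mean q (real (m n)) / occ_mean q (real n * t))
      * (occ_mean q (real n * t) / occ_mean q (real n)) / (real (\<rho> n) / occ_mean q (real n)))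
      \<longlonglongrightarrow> 1 * 1 * t powr \<theta> / 1"
    by (intro tendsto_divide tendsto_mult 1 2 3 \<rho>_asymp) simp
  then have "(\<lambda>n. real (\<rho> (m n)) / real (\<rho> n)) \<longlonglongrightarrow> t powr \<theta>"
    unfolding mult_1 div_by_1
  proof (rule Lim_transform_eventually)
    show "\<forall>\<^sub>F n in sequentially. (real (\<rho> (m n)) / occ_mean q (real (m n))) * (occ_mean q (real (m n)) / occ_mean q (real n * t))
      * (occ_mean q (real n * t) / occ_mean q (real n)) / (real (\<rho> n) / occ_mean q (real n)) = real (\<rho> (m n)) / real (\<rho> n)"
      using m_ge
    proof eventually_elim
      case (elim n)
      have "0 < real (m n)" "0 < real n * t" "0 < real n" using elim t by auto
      from this[THEN occ_mean_pos] show ?case by simp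
    qed
  qed
  then have "(\<lambda>n. ln (real (\<rho> (m n)) / real (\<rho> n))) \<longlonglongrightarrow> ln (t powr \<theta>)"
    using t by (intro tendsto_ln) auto
  moreover have "\<forall>\<^sub>F n in sequentially. ln (real (\<rho> (m n)) / real (\<rho> n)) = logp (real (\<rho> (m n))) - ln (real (\<rho> n))"
    using m_ge
  proof eventually_elim
    case (elim n)
    then show ?case
      using \<rho>_pos[of n] \<rho>_pos[of "m n"] by (subst ln_div) (simp_all add: logp_\<rho>)
  qed
  ultimately show ?thesis
    using t unfolding m_def by (simp add: ln_powr Lim_transform_eventually)
qed

text \<open>If \<open>[n t] = 0\<close>, then \<open>n * t < 1\<close> and
  \<open>\<rho> n \<le> n\<close> suffices; otherwise the path is replaced by the mean at both ends
  and concavity applies. Uniformity in \<open>n\<close> and \<open>t\<close> is what dominated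
  convergence asks for.\<close>

lemma log_increment_bound:
  obtains K where "\<And>n t. 1 \<le> n \<Longrightarrow> 0 < t \<Longrightarrow> t \<le> 1 \<Longrightarrow>
    \<bar>logp (real (\<rho> (nat \<lfloor>real n * t\<rfloor>))) - ln (real (\<rho> n))\<bar> \<le> K - ln t"
proof -
  have "(\<lambda>n. ln (real (\<rho> n) / occ_mean q (real n))) \<longlonglongrightarrow> ln 1"
    by (intro tendsto_ln \<rho>_asymp) simp
  then have "Bseq (\<lambda>n. ln (real (\<rho> n) / occ_mean q (real n)))"
    by (intro convergent_imp_Bseq) (auto simp: convergent_def)
  then obtain K0 where K0: "0 < K0" "\<And>n. norm (ln (real (\<rho> n) / occ_mean q (real n))) \<le> K0"
    by (auto elim: BseqE)
  have close: "\<bar>ln (real (\<rho> n)) - ln (occ_mean q (real n))\<bar> \<le> K0" if "1 \<le> n" for n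
    using K0(2)[of n] \<rho>_pos[OF that] occ_mean_pos[of "real n"] that by (simp add: ln_div)
  show thesis
  \<comment> \<open>\<open>2 * K0\<close> pays for replacing the path by the mean at
    \<open>m\<close> and at \<open>n\<close>; \<open>ln 2\<close> pays for rounding, as
    \<open>real n * t < real m + 1 \<le> 2 * real m\<close> when \<open>m \<ge> 1\<close>.\<close>
  proof (rule that[of "2 * K0 + ln 2"])
    fix n :: nat and t :: real assume n: "1 \<le> n" and t: "0 < t" "t \<le> 1"
    define m where "m = nat \<lfloor>real n * t\<rfloor>"
    have m_real: "real m = of_int \<lfloor>real n * t\<rfloor>" using t by (simp add: m_def)
    have m_le: "real m \<le> real n * t" "real n * t < real m + 1" unfolding m_real by linarith+
    have nt: "real n * t \<le> real n" using t by (simp add: mult_left_le)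
    have "m \<le> n" using m_le(1) nt by linarith
    show "\<bar>logp (real (\<rho> (nat \<lfloor>real n * t\<rfloor>))) - ln (real (\<rho> n))\<bar> \<le> 2 * K0 + ln 2 - ln t"
      unfolding m_def[symmetric]
    proof (cases "m = 0")
      case True
      have "\<rho> 0 = 0" using \<rho>_le[of 0] by simp
      \<comment> \<open>The convention \<open>logp 0 = 0\<close> enters here.\<close>
      then have "logp (real (\<rho> m)) = 0" using True by (simp add: logp_def)
      moreover have "0 \<le> ln (real (\<rho> n))" using \<rho>_pos[OF n] by simp
      moreover have "ln (real (\<rho> n)) \<le> ln (real n)"
        using \<rho>_pos[OF n] \<rho>_le[of n] n by (subst ln_le_cancel_iff) auto
      moreover have "ln (real n) \<le> - ln t"
      proof -
        have "ln (real n * t) \<le> ln 1"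
          using m_le(2) True n t by (subst ln_le_cancel_iff) auto
        then show ?thesis using n t by (simp add: ln_mult)
      qed
      moreover have "0 \<le> ln (2 :: real)" by simp
      ultimately show "\<bar>logp (real (\<rho> m)) - ln (real (\<rho> n))\<bar> \<le> 2 * K0 + ln 2 - ln t"
        using K0(1) by linarith
    next
      case False
      then have m: "1 \<le> m" by simp
      have "ln (real (\<rho> m)) \<le> ln (real (\<rho> n))"
        using \<rho>_pos[OF m] \<rho>_pos[OF n] \<rho>_mono[OF \<open>m \<le> n\<close>] by (subst ln_le_cancel_iff) auto
      moreover have "ln (occ_mean q (real n)) - ln (occ_mean q (real m)) \<le> ln (real n) - ln (real m)"
        using m \<open>m \<le> n\<close> by (intro ln_occ_mean_diff_le) auto
      moreover have "ln (real n) + ln t \<le> ln 2 + ln (real m)"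
      proof -
        have "ln (real n * t) \<le> ln (2 * real m)"
          using m_le m n t by (subst ln_le_cancel_iff) auto
        then show ?thesis using n t m by (simp add: ln_mult)
      qed
      ultimately show "\<bar>logp (real (\<rho> m)) - ln (real (\<rho> n))\<bar> \<le> 2 * K0 + ln 2 - ln t"
        using close[OF n] close[OF m] unfolding logp_\<rho>[OF m] by linarith
    qed
  qed
qed

end

end

lemma pmf_lt_1_if_pos:
  fixes D :: "nat pmf"
  assumes "0 < pmf D j" "i \<noteq> j"
  shows "pmf D i < 1"
proof -
  have "pmf D i + pmf D j = measure D {i, j}"
    using assms(2) by (simp add: measure_measure_pmf_finite)
  also have "\<dots> \<le> 1" by simp
  finally show ?thesis using assms(1) by simp
qed

text \<open>With the rates \<open>- ln (1 - p i)\<close> the discrete-time mean number of distinct words is exactly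
  \<open>occ_mean\<close>, so no Poissonization error has to be controlled.\<close>

definition word_rate :: "nat pmf \<Rightarrow> nat \<Rightarrow> real" where
  "word_rate D i = - ln (1 - pmf D i)"

context
  fixes D :: "nat pmf"
  assumes D0: "pmf D 0 = 0" and Dpos: "\<And>i. 1 \<le> i \<Longrightarrow> 0 < pmf D i"
begin

text \<open>At least two words have positive probability. Consequently \<open>word_rate\<close>
  never meets the default value \<open>ln 0\<close>.\<close>

lemma pmf_lt_1: "pmf D i < 1"
proof (cases "i = 1")
  case True
  then show ?thesis using Dpos[of 2] by (intro pmf_lt_1_if_pos[of D 2]) auto
next
  case False
  then show ?thesis using Dpos[of 1] by (intro pmf_lt_1_if_pos[of D 1]) auto
qed

lemma pmf_tendsto_at_right_0: "filterlim (pmf D) (at_right 0) sequentially"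
  unfolding filterlim_at
proof
  show "pmf D \<longlonglongrightarrow> 0" by (rule summable_LIMSEQ_zero[OF summable_pmf_nat])
  show "\<forall>\<^sub>F i in sequentially. pmf D i \<in> {0<..} \<and> pmf D i \<noteq> 0"
    using eventually_ge_at_top[of 1]
  proof eventually_elim
    case (elim i)
    then show ?case using Dpos[of i] by simp
  qed
qed

text \<open>First-order expansion of \<open>- ln (1 - p)\<close> at 0. It transfers both summability
  and ratio limits from probabilities to rates.\<close>

lemma word_rate_ratio: "(\<lambda>i. word_rate D i / pmf D i) \<longlonglongrightarrow> 1"
proof -
  have "((\<lambda>p::real. - ln (1 - p) / p) \<longlongrightarrow> 1) (at_right 0)" by real_asymp
  from filterlim_compose[OF this pmf_tendsto_at_right_0] show ?thesis
    by (simp add: word_rate_def)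
qed

lemma positive_rates_word_rate: "positive_rates (word_rate D)"
proof
  show nonneg: "0 \<le> word_rate D i" for i
    using pmf_lt_1[of i] by (simp add: word_rate_def)
  show "0 < word_rate D i" if "1 \<le> i" for i
    using pmf_lt_1[of i] Dpos[OF that] by (simp add: word_rate_def)
  have "\<forall>\<^sub>F i in sequentially. word_rate D i / pmf D i < 2"
    using order_tendstoD(2)[OF word_rate_ratio, of 2] by simp
  then have "\<forall>\<^sub>F i in sequentially. norm (word_rate D i) \<le> 2 * pmf D i"
    using eventually_ge_at_top[of 1]
  proof eventually_elim
    case (elim i)
    then show ?case using Dpos[of i] nonneg[of i] by (simp add: field_simps)
  qed
  then show "summable (word_rate D)"
    by (rule summable_comparison_test_ev) (intro summable_mult summable_pmf_nat)
qed

lemma exp_word_rate: "exp (- (real n * word_rate D i)) = (1 - pmf D i) ^ n"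
proof -
  have "exp (- (real n * word_rate D i)) = exp (ln (1 - pmf D i)) ^ n"
    by (simp add: word_rate_def flip: exp_of_nat_mult)
  then show ?thesis using pmf_lt_1[of i] by simp
qed

text \<open>The constant bounding the steps of the mean is \<open>occ_mean (word_rate D) 1\<close>,
  by subadditivity.\<close>

lemma AE_R_asymp_occ_mean:
  "AE \<omega> in stream_space (measure_pmf D).
     (\<lambda>n. real (R n \<omega>) / occ_mean (word_rate D) (real n)) \<longlonglongrightarrow> 1"
proof -
  interpret positive_rates "word_rate D" by (rule positive_rates_word_rate)
  show ?thesis
  proof (rule AE_R_asymp_mean)
    show "(\<lambda>i. 1 - (1 - pmf D i) ^ n) sums occ_mean (word_rate D) (real n)" for n
      using summable_sums[OF summable_occ_term[of "real n"]] unfolding occ_mean_def exp_word_rate by simp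
    show "mono (\<lambda>n. occ_mean (word_rate D) (real n))"
      by (intro monoI occ_mean_mono) auto
    show "filterlim (\<lambda>n. occ_mean (word_rate D) (real n)) at_top sequentially"
      by (rule filterlim_compose[OF occ_mean_at_top filterlim_real_sequentially])
    show "occ_mean (word_rate D) (real (Suc n)) \<le> occ_mean (word_rate D) (real n) + occ_mean (word_rate D) 1" for n
      using occ_mean_Suc_le[of "real n"] by (simp add: add.commute)
  qed
qed

end

theorem theorem2p1:
  fixes \<theta> :: real and D :: "nat pmf" and l :: "real \<Rightarrow> real \<Rightarrow> real"
    and A :: "real \<Rightarrow> real"
  assumes theta: "0 < \<theta>" "\<theta> \<le> 1"
    and D0: "pmf D 0 = 0"
    and Dpos: "\<forall>i\<ge>1. pmf D i > 0"
    and Dform: "\<forall>i\<ge>1. pmf D i = real i powr (-1 / \<theta>) * l (real i) \<theta>"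
    and sv: "slowly_varying (\<lambda>x. l x \<theta>)"
    and A_decomp: "\<exists>S C. step_fun_01 S \<and> piecewise_C1_01 C \<and> (\<forall>t\<in>{0..1}. A t = S t + C t)"
    and A_norm: "LS_integral ln A = 1"
    and A0: "A 0 = 0" and A0r: "(A \<longlongrightarrow> 0) (at_right 0)" and A1: "A 1 = 0"
  shows "AE \<omega> in stream_space (measure_pmf D). (\<lambda>n. theta_hat A n \<omega>) \<longlonglongrightarrow> \<theta>"
proof -
  have pos: "0 < pmf D i" if "1 \<le> i" for i using Dpos that by blast
  let ?q = "word_rate D"
  interpret positive_rates ?q by (rule positive_rates_word_rate[OF D0 pos])
  \<comment> \<open>The power contributes \<open>k powr (- 1 / \<theta>)\<close>, slow variation
    makes the quotient of \<open>l\<close> tend to 1, and passing from probabilities to rates brings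
    factors tending to 1.\<close>
  have ratio: "(\<lambda>i. ?q (k * i + r) / ?q i) \<longlonglongrightarrow> real k powr (- 1 / \<theta>)" if r: "r < k" for k r
  proof -
    have k: "1 \<le> k" using r by simp
    have lim_aff: "filterlim (\<lambda>i. k * i + r) at_top sequentially"
      by (rule filterlim_at_top_mono[OF filterlim_ident]) (use k in \<open>auto intro!: always_eventually trans_le_add1\<close>)
    have "(\<lambda>i. (real (k * i + r) / real i) powr (- 1 / \<theta>)) \<longlonglongrightarrow> real k powr (- 1 / \<theta>)"
    proof (rule tendsto_powr)
      show "(\<lambda>i. real (k * i + r) / real i) \<longlonglongrightarrow> real k"
        using k by (simp, real_asymp)
    qed (use k in auto)
    from tendsto_mult[OF this slowly_varying_ratio_affine[OF sv r]]
    have "(\<lambda>i. (real (k * i + r) / real i) powr (- 1 / \<theta>) * (l (real (k * i + r)) \<theta> / l (real i) \<theta>))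
        \<longlonglongrightarrow> real k powr (- 1 / \<theta>)" by simp
    then have 1: "(\<lambda>i. pmf D (k * i + r) / pmf D i) \<longlonglongrightarrow> real k powr (- 1 / \<theta>)"
    proof (rule Lim_transform_eventually)
      show "\<forall>\<^sub>F i in sequentially. (real (k * i + r) / real i) powr (- 1 / \<theta>) *
          (l (real (k * i + r)) \<theta> / l (real i) \<theta>) = pmf D (k * i + r) / pmf D i"
        using eventually_ge_at_top[of 1]
      proof eventually_elim
        case (elim i)
        have "1 \<le> k * i + r" using elim k by (simp add: trans_le_add1)
        then show ?case
          using Dform[rule_format, OF elim] Dform[rule_format, of "k * i + r"]
          by (simp add: powr_divide)
      qed
    qed
    have 2: "(\<lambda>i. ?q (k * i + r) / pmf D (k * i + r)) \<longlonglongrightarrow> 1"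
      by (rule filterlim_compose[OF word_rate_ratio[OF D0 pos] lim_aff])
    have "(\<lambda>i. (?q (k * i + r) / pmf D (k * i + r)) * (pmf D (k * i + r) / pmf D i) / (?q i / pmf D i))
        \<longlonglongrightarrow> 1 * real k powr (- 1 / \<theta>) / 1"
      by (intro tendsto_divide tendsto_mult 1 2 word_rate_ratio[OF D0 pos]) simp_all
    then show ?thesis
      unfolding mult_1 div_by_1
    proof (rule Lim_transform_eventually)
      show "\<forall>\<^sub>F i in sequentially. (?q (k * i + r) / pmf D (k * i + r)) * (pmf D (k * i + r) / pmf D i)
          / (?q i / pmf D i) = ?q (k * i + r) / ?q i"
        using eventually_ge_at_top[of 1]
      proof eventually_elim
        case (elim i)
        have "1 \<le> k * i + r" using elim k by (simp add: trans_le_add1)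
        from pos[OF this] pos[OF elim] show ?case by simp
      qed
    qed
  qed
  have rv: "((\<lambda>x. occ_mean ?q (c * x) / occ_mean ?q x) \<longlongrightarrow> c powr \<theta>) at_top" if "0 < c" for c
    by (rule occ_mean_regularly_varying[OF theta(1) ratio that])
  \<comment> \<open>Right continuity at 0 excludes an atom there, where the centred integrand
    \<open>- ln (R n \<omega>)\<close> would diverge.\<close>
  have jump0: "jump A 0 = 0"
    using tendsto_Lim[OF trivial_limit_at_right_real A0r] A0 by (simp add: jump_def)
  have "AE \<omega> in stream_space (measure_pmf D).
      (\<lambda>n. real (R n \<omega>) / occ_mean ?q (real n)) \<longlonglongrightarrow> 1"
    by (rule AE_R_asymp_occ_mean[OF D0 pos])
  then show ?thesis
  proof eventually_elim
    case (elim \<omega>)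
    let ?F = "\<lambda>n t. logp (real (R (nat \<lfloor>real n * t\<rfloor>) \<omega>))"
    obtain K where K: "\<And>n t. 1 \<le> n \<Longrightarrow> 0 < t \<Longrightarrow> t \<le> 1 \<Longrightarrow> \<bar>?F n t - ln (real (R n \<omega>))\<bar> \<le> K - ln t"
      by (rule log_increment_bound[of "\<lambda>n. R n \<omega>", OF R_mono R_pos R_le elim], assumption, assumption, rule that)
    \<comment> \<open>The bound \<open>K\<close> requires at least one draw, so the sequence is
      shifted to \<open>Suc n\<close> and shifted back at the end.\<close>
    have "(\<lambda>n. LS_integral (?F (Suc n)) A) \<longlonglongrightarrow> \<theta> * LS_integral ln A"
    proof (rule LS_integral_tendsto[OF A_decomp, where c = "\<lambda>n. ln (real (R (Suc n) \<omega>))" and K = K])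
      show "A 0 = A 1" using A0 A1 by simp
      show "jump A 0 = 0" by (rule jump0)
      show "?F (Suc n) \<in> borel_measurable borel" for n
        by measurable
      show "(\<lambda>n. ?F (Suc n) t - ln (real (R (Suc n) \<omega>))) \<longlonglongrightarrow> \<theta> * ln t" if t: "t \<in> {0<..1}" for t
        using LIMSEQ_Suc[OF log_increment_tendsto[OF R_mono R_pos R_le elim rv]] t by simp
      show "\<bar>?F (Suc n) t - ln (real (R (Suc n) \<omega>))\<bar> \<le> K - ln t" if "t \<in> {0<..1}" for n t
        using K[of "Suc n" t] that by simp
    qed
    then have "(\<lambda>n. theta_hat A (Suc n) \<omega>) \<longlonglongrightarrow> \<theta>"
      unfolding theta_hat_def A_norm by simp
    then show ?case by (rule LIMSEQ_imp_Suc)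
  qed
qed

end
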